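(* Let $\mathcal{L}$ be a finite ranked atomic lattice. For each building set $\mathcal{G}$ of $\mathcal{L}$ let $\chi^{arr}_{\mathcal{G}}:N(\mathcal{G})\to\mathbb{Z}$, $I\mapsto\mathrm{rk}_{\mathbb{Z}}D(\mathcal{L},\mathcal{G},I)$. Then the collection $(\chi^{arr}_{\mathcal{G}})_{\mathcal{G}}$ is an $N$-function; that is, whenever $\mathcal{G}_1$ and $\mathcal{G}_2=\mathcal{G}_1\cup\{b\}$ with $b\notin\mathcal{G}_1$ are building sets of $\mathcal{L}$, writing $F=F_{\mathcal{G}_1}(b)$, for every $S\in N(\mathcal{G}_2)$: $\chi^{arr}_{\mathcal{G}_2}(S)=\chi^{arr}_{\mathcal{G}_1}(S)$ if $b\notin S$ and $S\cup F\notin N(\mathcal{G}_1)$; $\chi^{arr}_{\mathcal{G}_2}(S)=\chi^{arr}_{\mathcal{G}_1}(S)+\chi^{arr}_{\mathcal{G}_1}(S\cup F)(|F\setminus S|-1)$ if $b\notin S$ and $S\cup F\in N(\mathcal{G}_1)$; $\chi^{arr}_{\mathcal{G}_2}(S)=\chi^{arr}_{\mathcal{G}_1}(S\setminus\{b\}\cup F)\,|F\setminus S|$ if $b\in S$.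
   Context: All posets are finite. For $S\subset\mathcal{L}$, $x\in\mathcal{L}$: $S_{<x}=\{y\in S:y<x\}$, $S_{\le x}$ similarly; $\max S$ is the set of maximal elements; $\bigvee T$ is the join. $\hat0$ is the least element; $[a,b]=\{x:a\le x\le b\}$; products of posets carry the componentwise order. Atoms are elements covering $\hat0$; $\mathcal{L}$ is ranked if all maximal chains from $\hat0$ to any $x$ have equal length, and atomic if every element is a join of atoms. A subset $\mathcal{G}\subset\mathcal{L}\setminus\{\hat0\}$ is a building set if for every $p\ne\hat0$ there is a poset isomorphism $\phi:[\hat0,p]\to\prod_{g\in F_{\mathcal{G}}(p)}[\hat0,g]$ with $\phi(g)=(\hat0,\dots,g,\dots,\hat0)$ for all $g\in F_{\mathcal{G}}(p)$, where $F_{\mathcal{G}}(p)=\max\{g\in\mathcal{G}:g\le p\}$. $N(\mathcal{G})$ is the set of all $S\subset\mathcal{G}$ (including $\emptyset$) such that for every $T\subset S$ with $|T|\ge2$ of pairwise incomparable elements, $\bigvee T\notin\mathcal{G}$. For $S,H\subset\mathcal{L}$ and $B\in\mathcal{L}$ with $\bigvee(H\cup S_{<B})\le B$, $d^S_{H,B}$ is the minimal number $m$ of atoms $A_1,\dots,A_m$ with $B=\bigvee(H\cup S_{<B}\cup\{A_1,\dots,A_m\})$. For $I\in N(\mathcal{G})$, $D(\mathcal{L},\mathcal{G},I)=\mathbb{Z}[\{x_g\}_{g\in\mathcal{G}}]/J_I$, where $J_I$ is generated by $\prod_{A\in H}x_A\big(\sum_{C\in\mathcal{G},C\ge B}x_C\big)^{d^I_{H,B}}$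 for all $H\subset\mathcal{G}$ and all $B\in\mathcal{G}$ with $B>h$ for all $h\in H$. $\mathrm{rk}_{\mathbb{Z}}$ is the rank of a finitely generated abelian group. *)

theory Defs
  imports
    "HOL-Library.Poly_Mapping"
    "HOL-Algebra.QuotRing"
begin

(* A finite lattice (nonempty, as it has a least element) is the same thing as a type of sort
   {finite, complete_lattice}; the least element is bot, the join of a set T is Sup T and the
   interval [bot, x] is {bot..x}. *)

section \<open>Ranked atomic lattices\<close>

definition ranked :: "'a::{finite, complete_lattice} itself \<Rightarrow> bool" where
  "ranked _ \<longleftrightarrow> (\<forall>(x::'a) C C'. pred_on.maxchain {bot..x} (<) C \<longrightarrow>
     pred_on.maxchain {bot..x} (<) C' \<longrightarrow> card C = card C')"

definition covers :: "'a::order \<Rightarrow> 'a \<Rightarrow> bool" where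
  "covers x y \<longleftrightarrow> y < x \<and> \<not> (\<exists>z. y < z \<and> z < x)"

definition atoms :: "'a::{finite, complete_lattice} set" where
  "atoms = {a. covers a bot}"

definition atomic :: "'a::{finite, complete_lattice} itself \<Rightarrow> bool" where
  "atomic _ \<longleftrightarrow> (\<forall>x::'a. \<exists>T \<subseteq> atoms. x = Sup T)"

section \<open>Building sets and nested sets\<close>

definition maximal_elements :: "'a::order set \<Rightarrow> 'a set" where
  "maximal_elements S = {x \<in> S. \<not> (\<exists>y \<in> S. x < y)}"

definition factors :: "'a::{finite, complete_lattice} set \<Rightarrow> 'a \<Rightarrow> 'a set" where
  "factors G p = maximal_elements {g \<in> G. g \<le> p}"

definition building_set :: "'a::{finite, complete_lattice} set \<Rightarrow> bool" where
  "building_set G \<longleftrightarrow> bot \<notin> G \<and>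
     (\<forall>p. p \<noteq> bot \<longrightarrow>
       (\<exists>\<phi> :: 'a \<Rightarrow> 'a \<Rightarrow> 'a.
          bij_betw \<phi> {bot..p} (\<Pi>\<^sub>E g \<in> factors G p. {bot..g}) \<and>
          (\<forall>x \<in> {bot..p}. \<forall>y \<in> {bot..p}.
             x \<le> y \<longleftrightarrow> (\<forall>g \<in> factors G p. \<phi> x g \<le> \<phi> y g)) \<and>
          (\<forall>g \<in> factors G p. \<forall>h \<in> factors G p. \<phi> g h = (if h = g then g else bot))))"

definition nested_sets :: "'a::{finite, complete_lattice} set \<Rightarrow> 'a set set" where
  "nested_sets G = {S. S \<subseteq> G \<and>
     (\<forall>T \<subseteq> S. card T \<ge> 2 \<longrightarrow>
        (\<forall>x \<in> T. \<forall>y \<in> T. x \<noteq> y \<longrightarrow> \<not> x \<le> y \<and> \<not> y \<le> x) \<longrightarrow> Sup T \<notin> G)}"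

section \<open>The rings \<open>D(L, G, I)\<close>\<close>

(* Only meaningful if Sup (H \<union> {y \<in> S. y < B}) \<le> B; in an atomic lattice a suitable set of atoms
   then exists. *)
definition atom_defect :: "'a::{finite, complete_lattice} set \<Rightarrow> 'a set \<Rightarrow> 'a \<Rightarrow> nat" where
  "atom_defect S H B =
     (LEAST m. \<exists>A \<subseteq> atoms. card A = m \<and> B = Sup (H \<union> {y \<in> S. y < B} \<union> A))"

(* Integer polynomials are finitely supported maps from monomials to coefficients, and monomials
   are finitely supported maps from variables to exponents. All lattice elements index variables
   here; int_poly_ring G is the subring of the polynomials involving only the x_g with g in G. *)
type_synonym 'a int_poly = "('a \<Rightarrow>\<^sub>0 nat) \<Rightarrow>\<^sub>0 int"

definition var :: "'a \<Rightarrow> 'a int_poly" where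
  "var g = Poly_Mapping.single (Poly_Mapping.single g 1) 1"

definition int_poly_ring :: "'a set \<Rightarrow> 'a int_poly ring" where
  "int_poly_ring G =
     \<lparr>carrier = {p. \<forall>m \<in> Poly_Mapping.keys p. Poly_Mapping.keys m \<subseteq> G},
      mult = (*), one = 1, zero = 0, add = (+)\<rparr>"

definition D_relations :: "'a::{finite, complete_lattice} set \<Rightarrow> 'a set \<Rightarrow> 'a int_poly set" where
  "D_relations G I =
     {(\<Prod>A\<in>H. var A) * (\<Sum>C\<in>{C \<in> G. B \<le> C}. var C) ^ atom_defect I H B | H B.
        H \<subseteq> G \<and> B \<in> G \<and> (\<forall>h \<in> H. h < B)}"

definition D_ring :: "'a::{finite, complete_lattice} set \<Rightarrow> 'a set \<Rightarrow> 'a int_poly set ring" where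
  "D_ring G I = int_poly_ring G Quot (Idl\<^bsub>int_poly_ring G\<^esub> (D_relations G I))"

lemma int_poly_ring_cring: "cring (int_poly_ring G)"
proof -
  have plus: "\<forall>m \<in> Poly_Mapping.keys (p + q). Poly_Mapping.keys m \<subseteq> G"
    if "\<forall>m \<in> Poly_Mapping.keys p. Poly_Mapping.keys m \<subseteq> G"
       "\<forall>m \<in> Poly_Mapping.keys q. Poly_Mapping.keys m \<subseteq> G" for p q :: "'a int_poly"
    using that Poly_Mapping.keys_add[of p q] by blast
  have times: "\<forall>m \<in> Poly_Mapping.keys (p * q). Poly_Mapping.keys m \<subseteq> G"
    if p: "\<forall>m \<in> Poly_Mapping.keys p. Poly_Mapping.keys m \<subseteq> G"
      and q: "\<forall>m \<in> Poly_Mapping.keys q. Poly_Mapping.keys m \<subseteq> G" for p q :: "'a int_poly"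
  proof
    fix m assume "m \<in> Poly_Mapping.keys (p * q)"
    then obtain a b where "m = a + b" "a \<in> Poly_Mapping.keys p" "b \<in> Poly_Mapping.keys q"
      using keys_mult[of p q] by blast
    then show "Poly_Mapping.keys m \<subseteq> G"
      using p q Poly_Mapping.keys_add[of a b] by blast
  qed
  show ?thesis
  proof (rule cringI)
    show "abelian_group (int_poly_ring G)"
    proof (rule abelian_groupI)
      fix x assume "x \<in> carrier (int_poly_ring G)"
      then show "\<exists>y \<in> carrier (int_poly_ring G).
          y \<oplus>\<^bsub>int_poly_ring G\<^esub> x = \<zero>\<^bsub>int_poly_ring G\<^esub>"
        by (intro bexI[of _ "- x"]) (simp_all add: int_poly_ring_def)
    next
      fix x y assume "x \<in> carrier (int_poly_ring G)" "y \<in> carrier (int_poly_ring G)"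
      then show "x \<oplus>\<^bsub>int_poly_ring G\<^esub> y \<in> carrier (int_poly_ring G)"
        unfolding int_poly_ring_def partial_object.simps ring.simps mem_Collect_eq
        by (rule plus)
    qed (simp_all add: int_poly_ring_def ac_simps)
    show "comm_monoid (int_poly_ring G)"
    proof (rule comm_monoidI)
      fix x y assume "x \<in> carrier (int_poly_ring G)" "y \<in> carrier (int_poly_ring G)"
      then show "x \<otimes>\<^bsub>int_poly_ring G\<^esub> y \<in> carrier (int_poly_ring G)"
        unfolding int_poly_ring_def partial_object.simps monoid.simps mem_Collect_eq
        by (rule times)
    qed (simp_all add: int_poly_ring_def ac_simps)
  qed (simp add: int_poly_ring_def distrib_right)
qed

lemma D_relations_subset_carrier: "D_relations G I \<subseteq> carrier (int_poly_ring G)"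
proof -
  let ?P = "carrier (int_poly_ring G)"
  have mult: "p * q \<in> ?P" and add: "p + q \<in> ?P" if "p \<in> ?P" "q \<in> ?P" for p q
    using cring.cring_simprules(1,5)[OF int_poly_ring_cring that]
    by (simp_all add: int_poly_ring_def)
  have units: "1 \<in> ?P" "0 \<in> ?P"
    by (simp_all add: int_poly_ring_def)
  have var: "var g \<in> ?P" if "g \<in> G" for g
    using that by (simp add: int_poly_ring_def var_def)
  have sum: "(\<Sum>C\<in>S. var C) \<in> ?P" if "S \<subseteq> G" for S
    using finite[of S] that by (induction S rule: finite_induct) (simp_all add: add units var)
  have prod: "(\<Prod>C\<in>S. var C) \<in> ?P" if "S \<subseteq> G" for S
    using finite[of S] that by (induction S rule: finite_induct) (simp_all add: mult units var)
  have pow: "p ^ n \<in> ?P" if "p \<in> ?P" for p n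
    using that by (induction n) (simp_all add: mult units)
  show ?thesis
  proof
    fix p assume "p \<in> D_relations G I"
    then obtain H B where "H \<subseteq> G"
      and p: "p = (\<Prod>A\<in>H. var A) * (\<Sum>C\<in>{C \<in> G. B \<le> C}. var C) ^ atom_defect I H B"
      unfolding D_relations_def by blast
    show "p \<in> ?P"
      unfolding p using \<open>H \<subseteq> G\<close> by (intro mult prod pow sum) auto
  qed
qed

section \<open>Ranks and \<open>N\<close>-functions\<close>

(* The rank of an abelian group is the maximal cardinality of a Z-linearly independent subset.
   The supremum is over a bounded set of naturals when the group is finitely generated. *)
definition ab_group_rank :: "('a, 'b) monoid_scheme \<Rightarrow> nat" where
  "ab_group_rank M = Sup {card X | X. finite X \<and> X \<subseteq> carrier M \<and>
     (\<forall>c :: 'a \<Rightarrow> int. finprod M (\<lambda>x. x [^]\<^bsub>M\<^esub> c x) X = \<one>\<^bsub>M\<^esub> \<longrightarrow> (\<forall>x \<in> X. c x = 0))}"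

definition chi_arr :: "'a::{finite, complete_lattice} set \<Rightarrow> 'a set \<Rightarrow> int" where
  "chi_arr G I = int (ab_group_rank (add_monoid (D_ring G I)))"

(* A family of functions \<chi> G : nested_sets G \<rightarrow> Z, for G a building set, is represented by a total
   function of which only these values are relevant. *)
definition N_function :: "('a::{finite, complete_lattice} set \<Rightarrow> 'a set \<Rightarrow> int) \<Rightarrow> bool" where
  "N_function \<chi> \<longleftrightarrow>
     (\<forall>G\<^sub>1 G\<^sub>2 b. building_set G\<^sub>1 \<longrightarrow> building_set G\<^sub>2 \<longrightarrow> G\<^sub>2 = G\<^sub>1 \<union> {b} \<longrightarrow> b \<notin> G\<^sub>1 \<longrightarrow>
       (let F = factors G\<^sub>1 b in
        \<forall>S \<in> nested_sets G\<^sub>2.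
          (b \<notin> S \<and> S \<union> F \<notin> nested_sets G\<^sub>1 \<longrightarrow> \<chi> G\<^sub>2 S = \<chi> G\<^sub>1 S) \<and>
          (b \<notin> S \<and> S \<union> F \<in> nested_sets G\<^sub>1 \<longrightarrow>
             \<chi> G\<^sub>2 S = \<chi> G\<^sub>1 S + \<chi> G\<^sub>1 (S \<union> F) * (int (card (F - S)) - 1)) \<and>
          (b \<in> S \<longrightarrow>
             \<chi> G\<^sub>2 S = \<chi> G\<^sub>1 ((S - {b}) \<union> F) * int (card (F - S)))))"

end

(* Write r(U, I) for the rank of the quotient of Z[x_g : g in U] by the relations D_relations U I,
   where U is an up-closed subset of a building set G, and d(I, B) for atom_defect I {} B. Adding a
   minimal element M to U is an algebraic blow-up: with A = D(U, I), A/N = D(U, insert M I),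
   k = d(I, M) and z the sum of the x_C with M < C, the ring D(insert M U, I) is
   A[x]/(x N, (x + z)^k), and z^k N = 0 in A. As in Keel's formula for the Chow ring of a blow-up this
   is A + (k - 1) copies of A/N, so r(insert M U, I) = r(U, I) + (d(I, M) - 1) r(U, insert M I).

   Let G2 = insert b G1 and let U be the set of elements not below b. The rings D(U, I + X) agree for
   all X with join b, because an element of U that bounds some element of X, but is not above b,
   has a vanishing variable. Unrolling the recursion over the elements below b therefore
   reduces the theorem to the identity
     sum_H w(I, H) d(I + H, b) = |F - I| sum_H w(I, H),
   with H ranging over the sets of elements of G1 below b and w(I, H) the product of the d(I + H, A) - 1
   over A in H. As d(., b) is the sum of the d(., f) over the f in F that are not in the set itself,
   it follows by pairing H with insert f H for each f. *)

theory Submission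
  imports Defs "HOL-Computational_Algebra.Polynomial"
begin

section \<open>Free quotients of additive groups\<close>

text \<open>Deleting a minimal element destroys the building property: a proper up-closed subset
  misses an atom, while every building set contains all atoms. So the recursion runs over up-closed
  subsets \<open>U\<close> of a fixed \<open>G\<close>, and the ring arguments keep only closure
  under joins of elements with a common lower bound in \<open>G\<close>. Likewise \<open>I\<close>
  is arbitrary, neither nested nor contained in \<open>U\<close>, because the blow-up step passes to
  \<open>insert M I\<close> with \<open>M\<close> outside \<open>U\<close>. This generality also
  unifies the three cases of the theorem:
  \<open>chi G2 I = chi G1 I + (|F - I| - 1) chi G1 (I + F)\<close> holds for every subset
  \<open>I\<close> of \<open>G2\<close>. If \<open>b\<close> is not in \<open>I\<close> and
  \<open>I + F\<close> is not nested, the ring of \<open>I + F\<close> is zero; if \<open>b\<close>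
  is in \<open>I\<close>, replacing \<open>b\<close> by \<open>F\<close> does not change the rank
  over \<open>G1\<close>. All rings are shown to be free over the integers, so that ranks add by
  concatenating bases.\<close>

definition additive_set :: "'r::comm_ring_1 set \<Rightarrow> bool" where
  "additive_set J \<longleftrightarrow> 0 \<in> J \<and> (\<forall>p \<in> J. \<forall>q \<in> J. p - q \<in> J)"

lemma additive_zero: "additive_set J \<Longrightarrow> 0 \<in> J"
  and additive_diff: "additive_set J \<Longrightarrow> p \<in> J \<Longrightarrow> q \<in> J \<Longrightarrow> p - q \<in> J"
  by (simp_all add: additive_set_def)

lemma additive_uminus: "additive_set J \<Longrightarrow> p \<in> J \<Longrightarrow> - p \<in> J"
  using additive_diff[of J 0 p] additive_zero[of J] by simp

lemma additive_add: "additive_set J \<Longrightarrow> p \<in> J \<Longrightarrow> q \<in> J \<Longrightarrow> p + q \<in> J"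
  using additive_diff[of J p "- q"] additive_uminus[of J q] by simp

lemma additive_sum: "additive_set J \<Longrightarrow> (\<And>i. i \<in> X \<Longrightarrow> f i \<in> J) \<Longrightarrow> sum f X \<in> J"
  by (induction X rule: infinite_finite_induct) (simp_all add: additive_zero additive_add)

lemma additive_of_int_mult:
  assumes "additive_set J" "p \<in> J"
  shows "of_int c * p \<in> J"
proof (induction c rule: int_induct[where k = 0])
  case base
  then show ?case using assms by (simp add: additive_zero)
next
  case (step1 i)
  then show ?case using assms by (simp add: additive_add distrib_right)
next
  case (step2 i)
  then show ?case using assms by (simp add: additive_diff left_diff_distrib)
qed

text \<open>For a subgroup \<open>J\<close> of \<open>A\<close>: the classes of the
  \<open>e i\<close> form a basis of \<open>A / J\<close>. Asking for a basis, rather than for the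
  value of the rank, makes additivity along a filtration elementary.\<close>

definition free_rank :: "'r::comm_ring_1 set \<Rightarrow> 'r set \<Rightarrow> nat \<Rightarrow> bool" where
  "free_rank A J n \<longleftrightarrow> (\<exists>e. (\<forall>i<n. e i \<in> A) \<and>
     (\<forall>p \<in> A. \<exists>c. p - (\<Sum>i<n. of_int (c i) * e i) \<in> J) \<and>
     (\<forall>c. (\<Sum>i<n. of_int (c i) * e i) \<in> J \<longrightarrow> (\<forall>i<n. c i = 0)))"

lemma free_rank_self: "additive_set J \<Longrightarrow> free_rank J J 0"
  by (simp add: free_rank_def)

text \<open>Bases are concatenated. For independence, a relation is read modulo \<open>K\<close>
  first, where only the \<open>e i\<close> survive; once their coefficients vanish, the rest is a
  relation in \<open>K / J\<close>.\<close>

lemma free_rank_trans: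
  assumes AK: "free_rank A K n" and KJ: "free_rank K J m"
    and "J \<subseteq> K" "K \<subseteq> A" "additive_set K"
  shows "free_rank A J (n + m)"
proof -
  obtain e where e: "\<And>i. i < n \<Longrightarrow> e i \<in> A"
      "\<And>p. p \<in> A \<Longrightarrow> \<exists>c. p - (\<Sum>i<n. of_int (c i) * e i) \<in> K"
      "\<And>c. (\<Sum>i<n. of_int (c i) * e i) \<in> K \<Longrightarrow> \<forall>i<n. c i = 0"
    using AK unfolding free_rank_def by blast
  obtain f where f: "\<And>i. i < m \<Longrightarrow> f i \<in> K"
      "\<And>p. p \<in> K \<Longrightarrow> \<exists>c. p - (\<Sum>i<m. of_int (c i) * f i) \<in> J"
      "\<And>c. (\<Sum>i<m. of_int (c i) * f i) \<in> J \<Longrightarrow> \<forall>i<m. c i = 0"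
    using KJ unfolding free_rank_def by blast
  define g where "g i = (if i < n then e i else f (i - n))" for i
  have split: "(\<Sum>i<n+m. of_int (c i) * g i) =
      (\<Sum>i<n. of_int (c i) * e i) + (\<Sum>i<m. of_int (c (n + i)) * f i)" for c
  proof -
    have "(\<Sum>i<n+m. of_int (c i) * g i) =
        (\<Sum>i<n. of_int (c i) * g i) + (\<Sum>i=n..<n+m. of_int (c i) * g i)"
      by (simp add: lessThan_atLeast0 sum.atLeastLessThan_concat)
    also have "(\<Sum>i=n..<n+m. of_int (c i) * g i) = (\<Sum>i<m. of_int (c (n + i)) * g (n + i))"
      using sum.shift_bounds_nat_ivl[of "\<lambda>i. of_int (c i) * g i" 0 n m]
      by (simp add: lessThan_atLeast0 add.commute)
    finally show ?thesis by (simp add: g_def)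
  qed
  show ?thesis
    unfolding free_rank_def
  proof (intro exI[of _ g] conjI ballI allI impI)
    fix i assume "i < n + m"
    then show "g i \<in> A" using e(1) f(1) \<open>K \<subseteq> A\<close> by (auto simp: g_def)
  next
    fix p assume "p \<in> A"
    then obtain c where "p - (\<Sum>i<n. of_int (c i) * e i) \<in> K" using e(2) by blast
    then obtain d where d: "p - (\<Sum>i<n. of_int (c i) * e i) - (\<Sum>i<m. of_int (d i) * f i) \<in> J"
      using f(2) by blast
    define c' where "c' i = (if i < n then c i else d (i - n))" for i
    have "p - (\<Sum>i<n+m. of_int (c' i) * g i) \<in> J"
      using d unfolding split by (simp add: c'_def diff_diff_eq)
    then show "\<exists>c. p - (\<Sum>i<n+m. of_int (c i) * g i) \<in> J" by blast
  next
    fix c i assume *: "(\<Sum>i<n+m. of_int (c i) * g i) \<in> J" and i: "i < n + m"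
    have "(\<Sum>i<m. of_int (c (n + i)) * f i) \<in> K"
      using f(1) \<open>additive_set K\<close> by (intro additive_sum additive_of_int_mult) auto
    moreover have "(\<Sum>i<n+m. of_int (c i) * g i) \<in> K" using * \<open>J \<subseteq> K\<close> by blast
    ultimately have "(\<Sum>i<n. of_int (c i) * e i) \<in> K"
      using additive_diff[OF \<open>additive_set K\<close>] unfolding split by fastforce
    then have 0: "\<forall>i<n. c i = 0" using e(3) by blast
    then have "(\<Sum>i<m. of_int (c (n + i)) * f i) \<in> J" using * unfolding split by simp
    then have "\<forall>i<m. c (n + i) = 0" using f(3)[of "\<lambda>i. c (n + i)"] by blast
    then have "c i = 0" if "\<not> i < n" using that i by (metis add_diff_inverse_nat nat_add_left_cancel_less)
    with 0 show "c i = 0" by blast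
  qed
qed

text \<open>The assumption \<open>iff\<close> makes the induced map from \<open>A / J\<close> to
  \<open>A' / J'\<close> well defined and injective. Additivity of \<open>f\<close> suffices, so
  that \<open>\<lambda>a. monom a i\<close> is covered as well as evaluation at a variable.\<close>

lemma free_rank_transport:
  fixes f :: "'r::comm_ring_1 \<Rightarrow> 's::comm_ring_1"
  assumes "free_rank A J n" "additive_set A" "additive_set J'"
    and add: "\<And>a b. f (a + b) = f a + f b"
    and mem: "\<And>a. a \<in> A \<Longrightarrow> f a \<in> A'"
    and iff: "\<And>a. a \<in> A \<Longrightarrow> f a \<in> J' \<longleftrightarrow> a \<in> J"
    and surj: "\<And>p. p \<in> A' \<Longrightarrow> \<exists>a \<in> A. p - f a \<in> J'"
  shows "free_rank A' J' n"
proof -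
  have zero: "f 0 = 0" using add[of 0 0] by simp
  have minus: "f (- a) = - f a" for a using add[of a "- a"] by (simp add: zero eq_neg_iff_add_eq_0 add.commute)
  have diff: "f (a - b) = f a - f b" for a b using add[of a "- b"] by (simp add: minus)
  have sum: "f (sum g X) = (\<Sum>i\<in>X. f (g i))" for g and X :: "nat set"
    by (induction X rule: infinite_finite_induct) (simp_all add: zero add)
  have scale: "f (of_int c * a) = of_int c * f a" for c a
    by (induction c rule: int_induct[where k = 0]) (simp_all add: zero add diff distrib_right left_diff_distrib)
  obtain e where e: "\<And>i. i < n \<Longrightarrow> e i \<in> A"
      "\<And>p. p \<in> A \<Longrightarrow> \<exists>c. p - (\<Sum>i<n. of_int (c i) * e i) \<in> J"
      "\<And>c. (\<Sum>i<n. of_int (c i) * e i) \<in> J \<Longrightarrow> \<forall>i<n. c i = 0"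
    using assms(1) unfolding free_rank_def by blast
  have mem_comb: "(\<Sum>i<n. of_int (c i) * e i) \<in> A" for c
    using e(1) assms(2) by (intro additive_sum additive_of_int_mult) auto
  have comb: "(\<Sum>i<n. of_int (c i) * f (e i)) = f (\<Sum>i<n. of_int (c i) * e i)" for c
    by (simp add: sum scale)
  show ?thesis
    unfolding free_rank_def
  proof (intro exI[of _ "\<lambda>i. f (e i)"] conjI ballI allI impI)
    fix p assume "p \<in> A'"
    then obtain a where a: "a \<in> A" "p - f a \<in> J'" using surj by blast
    then obtain c where "a - (\<Sum>i<n. of_int (c i) * e i) \<in> J" using e(2) by blast
    then have "f (a - (\<Sum>i<n. of_int (c i) * e i)) \<in> J'"
      using iff additive_diff[OF assms(2)] mem_comb a(1) by blast
    then have "p - f a + f (a - (\<Sum>i<n. of_int (c i) * e i)) \<in> J'"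
      using a(2) additive_add[OF assms(3)] by blast
    then show "\<exists>c. p - (\<Sum>i<n. of_int (c i) * f (e i)) \<in> J'"
      unfolding comb by (auto simp: diff)
  next
    fix c i assume "(\<Sum>i<n. of_int (c i) * f (e i)) \<in> J'" "i < n"
    then show "c i = 0" unfolding comb using iff mem_comb e(3) by blast
  qed (simp add: e mem)
qed

lemma free_rank_filtration:
  assumes "\<And>i. i < k \<Longrightarrow> free_rank (L i) (L (Suc i)) (n i)"
    and "\<And>i. i < k \<Longrightarrow> L (Suc i) \<subseteq> L i" and "\<And>i. i \<le> k \<Longrightarrow> additive_set (L i)"
  shows "free_rank (L 0) (L k) (\<Sum>i<k. n i)"
  using assms
proof (induction k)
  case 0
  then show ?case by (simp add: free_rank_self)
next
  case (Suc k)
  have sub: "j \<le> k \<Longrightarrow> L j \<subseteq> L 0" for j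
  proof (induction j)
    case (Suc j)
    then show ?case using Suc.prems(1) \<open>\<And>i. i < Suc k \<Longrightarrow> L (Suc i) \<subseteq> L i\<close>[of j] by auto
  qed simp
  have "free_rank (L 0) (L k) (\<Sum>i<k. n i)"
    using Suc.prems by (intro Suc.IH) simp_all
  then have "free_rank (L 0) (L (Suc k)) ((\<Sum>i<k. n i) + n k)"
    by (rule free_rank_trans) (simp_all add: Suc.prems sub)
  then show ?case by simp
qed

section \<open>A blow-up formula\<close>

definition subring_set :: "'r::comm_ring_1 set \<Rightarrow> bool" where
  "subring_set A \<longleftrightarrow> additive_set A \<and> 1 \<in> A \<and> (\<forall>a \<in> A. \<forall>b \<in> A. a * b \<in> A)"

definition ideal_set :: "'r::comm_ring_1 set \<Rightarrow> 'r set \<Rightarrow> bool" where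
  "ideal_set A J \<longleftrightarrow> additive_set J \<and> J \<subseteq> A \<and> (\<forall>a \<in> A. \<forall>j \<in> J. a * j \<in> J)"

definition polys_over :: "'r::comm_ring_1 set \<Rightarrow> 'r poly set" where
  "polys_over A = {q. \<forall>i. coeff q i \<in> A}"

lemma polys_overD: "q \<in> polys_over A \<Longrightarrow> coeff q i \<in> A"
  by (simp add: polys_over_def)

lemma additive_polys_over: "additive_set A \<Longrightarrow> additive_set (polys_over A)"
  by (simp add: additive_set_def polys_over_def)

lemma mult_polys_over:
  assumes "additive_set J" "\<And>a j. a \<in> A \<Longrightarrow> j \<in> J \<Longrightarrow> a * j \<in> J" "p \<in> polys_over A" "q \<in> polys_over J"
  shows "p * q \<in> polys_over J"
  using assms by (auto simp: polys_over_def coeff_mult intro!: additive_sum)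

lemma subring_polys_over: "subring_set A \<Longrightarrow> subring_set (polys_over A)"
  using additive_polys_over[of A] mult_polys_over[of A A]
  by (auto simp: subring_set_def) (auto simp: polys_over_def coeff_1 additive_zero)

text \<open>For ideals \<open>J0 \<subseteq> J1\<close> of \<open>A\<close> this is the ideal of
  \<open>A[x]\<close> generated by \<open>J0\<close> and \<open>x * J1\<close>, the preimage of the
  ideal \<open>(x N)\<close> over \<open>A / J0\<close> with \<open>N = J1 / J0\<close>.\<close>

definition blowup_base :: "'r::comm_ring_1 set \<Rightarrow> 'r set \<Rightarrow> 'r poly set" where
  "blowup_base J0 J1 = {q. coeff q 0 \<in> J0 \<and> (\<forall>i>0. coeff q i \<in> J1)}"

definition blowup_ideal :: "'r::comm_ring_1 set \<Rightarrow> 'r set \<Rightarrow> 'r set \<Rightarrow> 'r poly \<Rightarrow> 'r poly set" where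
  "blowup_ideal A J0 J1 p = {r + p * s | r s. r \<in> blowup_base J0 J1 \<and> s \<in> polys_over A}"

text \<open>\<open>A / J0\<close> is the ring being blown up and \<open>A / J1\<close> the ring of
  the center. Of \<open>(x + z) ^ k\<close> the features kept are that it is monic of degree
  \<open>k\<close> over \<open>A\<close> and that its constant term kills
  \<open>J1 / J0\<close>.\<close>

locale blowup =
  fixes A J0 J1 :: "'r::comm_ring_1 set" and p :: "'r poly" and k :: nat
  assumes A: "subring_set A" and J0: "ideal_set A J0" and J1: "ideal_set A J1" and J01: "J0 \<subseteq> J1"
    and p: "p \<in> polys_over A" "coeff p k = 1" "degree p = k" and k: "k > 0"
    and const: "\<And>a. a \<in> J1 \<Longrightarrow> a * coeff p 0 \<in> J0"
begin

abbreviation "K \<equiv> blowup_base J0 J1"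
abbreviation "J \<equiv> blowup_ideal A J0 J1 p"

lemma add_A: "additive_set A" and add_J0: "additive_set J0" and add_J1: "additive_set J1"
  using A J0 J1 by (simp_all add: subring_set_def ideal_set_def)

lemma add_K: "additive_set K"
  using add_J0 add_J1 by (simp add: additive_set_def blowup_base_def)

lemma K_coeff: "q \<in> K \<Longrightarrow> coeff q i \<in> J1"
  using J01 by (cases i) (auto simp: blowup_base_def)

lemma K_mult:
  assumes a: "a \<in> polys_over A" and q: "q \<in> K"
  shows "a * q \<in> K"
proof -
  have "a * q \<in> polys_over J1"
    using J1 by (intro mult_polys_over[OF add_J1 _ a]) (auto simp: ideal_set_def polys_over_def K_coeff[OF q])
  moreover have "coeff (a * q) 0 \<in> J0"
    using J0 polys_overD[OF a] q by (auto simp: coeff_mult ideal_set_def blowup_base_def)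
  ultimately show ?thesis by (simp add: blowup_base_def polys_over_def)
qed

lemma K_polys_over: "K \<subseteq> polys_over A"
  using J1 K_coeff by (auto simp: polys_over_def ideal_set_def)

lemma ideal_J: "ideal_set (polys_over A) J"
  unfolding ideal_set_def
proof (intro conjI ballI subsetI)
  note AX = subring_polys_over[OF A]
  then have addX: "additive_set (polys_over A)" by (simp add: subring_set_def)
  show "additive_set J"
    unfolding additive_set_def
  proof (intro conjI ballI)
    have "0 + p * 0 \<in> J"
      unfolding blowup_ideal_def using additive_zero[OF add_K] additive_zero[OF addX] by blast
    then show "0 \<in> J" by simp
    fix u v assume "u \<in> J" "v \<in> J"
    then obtain r s r' s' where *: "u = r + p * s" "v = r' + p * s'"
        "r \<in> K" "r' \<in> K" "s \<in> polys_over A" "s' \<in> polys_over A"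
      unfolding blowup_ideal_def by blast
    have "u - v = (r - r') + p * (s - s')" by (simp add: * algebra_simps)
    then show "u - v \<in> J"
      unfolding blowup_ideal_def using * additive_diff[OF add_K] additive_diff[OF addX] by blast
  qed
  fix u assume "u \<in> J"
  then obtain r s where *: "u = r + p * s" "r \<in> K" "s \<in> polys_over A"
    unfolding blowup_ideal_def by blast
  show "u \<in> polys_over A"
    using * p(1) K_polys_over AX by (auto simp: subring_set_def intro!: additive_add)
  fix a assume a: "a \<in> polys_over A"
  have "a * u = a * r + p * (a * s)" by (simp add: * algebra_simps)
  then show "a * u \<in> J"
    unfolding blowup_ideal_def using K_mult[OF a] * AX a unfolding subring_set_def by blast
qed

lemma K_subset_J: "K \<subseteq> J"
proof
  fix r assume "r \<in> K"
  moreover have "0 \<in> polys_over A" using additive_zero[OF add_A] by (simp add: polys_over_def)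
  ultimately have "r + p * 0 \<in> J" unfolding blowup_ideal_def by blast
  then show "r \<in> J" by simp
qed

text \<open>All coefficients of \<open>a * p\<close> lie in \<open>J1\<close>; only the constant one
  has to lie in the smaller ideal \<open>J0\<close>, and this is the assumption
  \<open>const\<close>.\<close>

lemma p_monom_K:
  assumes a: "a \<in> J1"
  shows "p * monom a n \<in> K"
proof -
  have coeff: "coeff (p * monom a n) i = (if n \<le> i then coeff p (i - n) * a else 0)" for i
    using coeff_monom_mult[of a n p i] by (simp add: mult.commute)
  have "coeff p i * a \<in> J1" for i
    using a J1 polys_overD[OF p(1)] by (simp add: ideal_set_def)
  moreover have "coeff p 0 * a \<in> J0"
    using const[OF a] by (simp add: mult.commute)
  ultimately show ?thesis
    using additive_zero[OF add_J0] additive_zero[OF add_J1] by (simp add: blowup_base_def coeff)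
qed

text \<open>Since \<open>p\<close> is monic, comparing top coefficients forces the leading coefficient of the
  multiplier into \<open>J1\<close>, and then its leading term can be moved into \<open>K\<close>.\<close>

lemma degree_less_J_aux:
  "s \<in> polys_over A \<Longrightarrow> r \<in> K \<Longrightarrow> degree (r + p * s) < k \<Longrightarrow> r + p * s \<in> K"
\<comment> \<open>The shifted measure puts the zero polynomial strictly below the nonzero constants,
  which share its degree 0.\<close>
proof (induction "if s = 0 then 0 else Suc (degree s)" arbitrary: r s rule: less_induct)
  case less
  show ?case
  proof (cases "s = 0")
    case True
    then show ?thesis using less.prems by simp
  next
    case False
    define n a where "n = degree s" and "a = coeff s n"
    have "coeff (p * s) (k + n) = a"
      using coeff_mult_degree_sum[of p s] p by (simp add: n_def a_def)
    moreover have "coeff (r + p * s) (k + n) = 0"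
      using less.prems(3) by (intro coeff_eq_0) simp
    ultimately have "a = - coeff r (k + n)" by (simp add: eq_neg_iff_add_eq_0 add.commute)
    then have a: "a \<in> J1" using K_coeff[OF less.prems(2)] additive_uminus[OF add_J1] by simp
    define s' where "s' = s - monom a n"
    have s': "s' \<in> polys_over A"
      unfolding s'_def using a J1 less.prems(1) additive_zero[OF add_A] additive_diff[OF add_A]
      by (auto simp: polys_over_def ideal_set_def)
    have "degree s' < degree s" if "s' \<noteq> 0"
    proof -
      have "degree s' \<le> degree s"
        unfolding s'_def by (intro degree_diff_le) (auto simp: n_def degree_monom_le)
      moreover have "coeff s' (degree s) = 0" by (simp add: s'_def a_def n_def)
      ultimately show ?thesis using that eq_zero_or_degree_less[of s' "degree s"] by blast
    qed
    then have "(if s' = 0 then 0 else Suc (degree s')) < (if s = 0 then 0 else Suc (degree s))"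
      using False by auto
    moreover have "r + p * monom a n \<in> K"
      using less.prems(2) p_monom_K[OF a] by (rule additive_add[OF add_K])
    moreover have eq: "r + p * monom a n + p * s' = r + p * s"
      by (simp add: s'_def algebra_simps)
    ultimately show ?thesis
      using less.hyps[of s' "r + p * monom a n", OF _ s'] less.prems(3) unfolding eq by blast
  qed
qed

text \<open>The uniqueness half of division with remainder by \<open>p\<close>: a remainder of
  degree below \<open>k\<close> vanishes modulo \<open>J\<close> only if its coefficients vanish
  modulo \<open>J0\<close> and \<open>J1\<close>.\<close>

lemma degree_less_J: "q \<in> J \<Longrightarrow> degree q < k \<Longrightarrow> q \<in> K"
  using degree_less_J_aux unfolding blowup_ideal_def by blast

lemma division:
  "q \<in> polys_over A \<Longrightarrow> \<exists>r \<in> polys_over A. degree r < k \<and> q - r \<in> J"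
proof (induction "degree q" arbitrary: q rule: less_induct)
  case less
  note addJ = ideal_J[unfolded ideal_set_def, THEN conjunct1]
  show ?case
  proof (cases "degree q < k")
    case True
    then show ?thesis using less.prems additive_zero[OF addJ] by (intro bexI[of _ q]) auto
  next
    case False
    define a n where "a = coeff q (degree q)" and "n = degree q - k"
    define q' where "q' = q - p * monom a n"
    have m: "monom a n \<in> polys_over A"
      using less.prems additive_zero[OF add_A] by (auto simp: polys_over_def a_def)
    then have pm: "p * monom a n \<in> polys_over A"
      using subring_polys_over[OF A] p(1) by (auto simp: subring_set_def)
    then have q': "q' \<in> polys_over A"
      unfolding q'_def using less.prems additive_diff additive_polys_over[OF add_A] by blast
    have "0 + p * monom a n \<in> J"
      unfolding blowup_ideal_def using m additive_zero[OF add_K] by blast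
    then have pmJ: "p * monom a n \<in> J" by simp
    have "degree (p * monom a n) \<le> degree q"
      using degree_mult_le[of p "monom a n"] degree_monom_le[of a n] False p(3) by (simp add: n_def)
    then have "degree q' \<le> degree q" unfolding q'_def by (intro degree_diff_le) auto
    moreover have "coeff q' (degree q) = 0"
    proof -
      have "coeff (p * monom a n) (k + n) = a"
        using coeff_monom_mult[of a n p "k + n"] p(2) by (simp add: mult.commute)
      then show ?thesis using False by (simp add: q'_def a_def n_def)
    qed
    ultimately have "degree q' < degree q \<or> degree q' < k"
      using k eq_zero_or_degree_less[of q' "degree q"] by auto
    then have "\<exists>r \<in> polys_over A. degree r < k \<and> q' - r \<in> J"
    proof
      assume "degree q' < k"
      then show ?thesis using q' additive_zero[OF addJ] by (intro bexI[of _ q']) auto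
    qed (rule less.hyps[OF _ q'])
    then obtain r where r: "r \<in> polys_over A" "degree r < k" "q' - r \<in> J" by blast
    have "(q' - r) + p * monom a n \<in> J" using r(3) pmJ by (rule additive_add[OF addJ])
    then have "q - r \<in> J" by (simp add: q'_def algebra_simps)
    with r show ?thesis by blast
  qed
qed

text \<open>Polynomials whose remainder modulo \<open>J\<close> can be chosen divisible by
  \<open>x ^ i\<close>. This filtration of \<open>A[x]\<close> descends to \<open>J\<close> at
  \<open>i = k\<close>, and each step is measured by the single coefficient of
  \<open>x ^ i\<close>.\<close>

definition layer :: "nat \<Rightarrow> 'r poly set" where
  "layer i = {q + j | q j. q \<in> polys_over A \<and> degree q < k \<and> (\<forall>l<i. coeff q l = 0) \<and> j \<in> J}"

lemma additive_layer: "additive_set (layer i)"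
  unfolding additive_set_def
proof (intro conjI ballI)
  have addJ: "additive_set J" and addX: "additive_set (polys_over A)"
    using ideal_J additive_polys_over[OF add_A] by (simp_all add: ideal_set_def)
  have "0 + 0 \<in> layer i"
    unfolding layer_def using additive_zero[OF addJ] additive_zero[OF addX] k by fastforce
  then show "0 \<in> layer i" by simp
  fix u v assume "u \<in> layer i" "v \<in> layer i"
  then obtain q j q' j' where *: "u = q + j" "v = q' + j'" "j \<in> J" "j' \<in> J" "degree q < k" "degree q' < k"
     "q \<in> polys_over A" "q' \<in> polys_over A" "\<forall>l<i. coeff q l = 0" "\<forall>l<i. coeff q' l = 0"
    unfolding layer_def by blast
  have "u - v = (q - q') + (j - j')" by (simp add: *)
  moreover have "degree (q - q') < k" using * by (simp add: degree_diff_less)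
  moreover have "\<forall>l<i. coeff (q - q') l = 0" using * by simp
  ultimately show "u - v \<in> layer i"
    unfolding layer_def using * additive_diff[OF addJ] additive_diff[OF addX] by blast
qed

lemma layer_0: "layer 0 = polys_over A"
proof
  show "layer 0 \<subseteq> polys_over A"
    using ideal_J additive_add[OF additive_polys_over[OF add_A]]
    unfolding layer_def ideal_set_def by blast
  show "polys_over A \<subseteq> layer 0"
  proof
    fix q assume "q \<in> polys_over A"
    then obtain r where "r \<in> polys_over A" "degree r < k" "q - r \<in> J" using division by blast
    moreover have "q = r + (q - r)" by simp
    ultimately show "q \<in> layer 0" unfolding layer_def by blast
  qed
qed

lemma layer_k: "layer k = J"
proof
  show "layer k \<subseteq> J"
  proof
    fix u assume "u \<in> layer k"
    then obtain q j where *: "u = q + j" "j \<in> J" "degree q < k" "\<forall>l<k. coeff q l = 0"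
      unfolding layer_def by blast
    then have "q = 0" by (metis leading_coeff_0_iff)
    then show "u \<in> J" using * by simp
  qed
  show "J \<subseteq> layer k"
  proof
    fix j assume "j \<in> J"
    moreover have "0 \<in> polys_over A" using additive_zero[OF add_A] by (simp add: polys_over_def)
    ultimately have "0 + j \<in> layer k" unfolding layer_def using k by fastforce
    then show "j \<in> layer k" by simp
  qed
qed

lemma layer_antimono: "layer (Suc i) \<subseteq> layer i"
  unfolding layer_def by fastforce

text \<open>The quotient of consecutive layers is \<open>A\<close> modulo the ideal that
  \<open>K\<close> prescribes for the coefficient of \<open>x ^ i\<close>: \<open>J0\<close> for the
  constant term and \<open>J1\<close> otherwise. This asymmetry yields one copy of
  \<open>A / J0\<close> and \<open>k - 1\<close> copies of \<open>A / J1\<close>.\<close>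

lemma free_rank_layer:
  assumes i: "i < k" and fr: "free_rank A (if i = 0 then J0 else J1) n"
  shows "free_rank (layer i) (layer (Suc i)) n"
proof (rule free_rank_transport[OF fr add_A additive_layer, of "\<lambda>a. monom a i"])
  have addJ: "additive_set J" using ideal_J by (simp add: ideal_set_def)
  show "monom (a + b) i = monom a i + monom b i" for a b by (simp add: add_monom)
  have monom: "monom a i \<in> polys_over A" "degree (monom a i) < k" if "a \<in> A" for a
    using that additive_zero[OF add_A] degree_monom_le[of a i] i by (auto simp: polys_over_def)
  show "monom a i \<in> layer i" if "a \<in> A" for a
  proof -
    have "monom a i + 0 \<in> layer i"
      unfolding layer_def using monom[OF that] additive_zero[OF addJ] by fastforce
    then show ?thesis by simp
  qed
  show "monom a i \<in> layer (Suc i) \<longleftrightarrow> a \<in> (if i = 0 then J0 else J1)" if a: "a \<in> A" for a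
  proof
    assume "monom a i \<in> layer (Suc i)"
    then obtain q j where *: "monom a i = q + j" "j \<in> J" "degree q < k" "coeff q i = 0"
      unfolding layer_def by blast
    have j: "j = monom a i - q" using * by simp
    then have "degree j < k" using degree_diff_less[OF monom(2)[OF a] *(3)] by simp
    then have "j \<in> K" using * degree_less_J by blast
    moreover have "coeff j i = a" unfolding j using *(4) by simp
    ultimately show "a \<in> (if i = 0 then J0 else J1)" by (auto simp: blowup_base_def)
  next
    assume "a \<in> (if i = 0 then J0 else J1)"
    then have "monom a i \<in> K"
      using additive_zero[OF add_J0] additive_zero[OF add_J1]
      by (auto simp: blowup_base_def split: if_splits)
    then have "0 + monom a i \<in> layer (Suc i)"
      unfolding layer_def using K_subset_J additive_zero[OF add_A] k by (fastforce simp: polys_over_def)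
    then show "monom a i \<in> layer (Suc i)" by simp
  qed
  show "\<exists>a \<in> A. u - monom a i \<in> layer (Suc i)" if u: "u \<in> layer i" for u
  proof -
    obtain q j where *: "u = q + j" "j \<in> J" "q \<in> polys_over A" "degree q < k" "\<forall>l<i. coeff q l = 0"
      using u unfolding layer_def by blast
    define a where "a = coeff q i"
    have a: "a \<in> A" using * polys_overD a_def by blast
    have "u - monom a i = (q - monom a i) + j" by (simp add: *)
    moreover have "q - monom a i \<in> polys_over A"
      using * monom[OF a] additive_diff[OF additive_polys_over[OF add_A]] by blast
    moreover have "degree (q - monom a i) < k" using * monom[OF a] by (simp add: degree_diff_less)
    moreover have "\<forall>l<Suc i. coeff (q - monom a i) l = 0"
      using * by (auto simp: a_def less_Suc_eq)
    ultimately have "u - monom a i \<in> layer (Suc i)" unfolding layer_def using * by blast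
    then show ?thesis using a by blast
  qed
qed

lemma free_rank_blowup:
  assumes "free_rank A J0 n0" "free_rank A J1 n1"
  shows "free_rank (polys_over A) J (n0 + (k - 1) * n1)"
proof -
  have "free_rank (layer 0) (layer k) (\<Sum>i<k. if i = 0 then n0 else n1)"
    using assms by (intro free_rank_filtration free_rank_layer layer_antimono additive_layer) auto
  moreover have "(\<Sum>i<k. if i = 0 then n0 else n1) = n0 + (k - 1) * n1"
  proof -
    obtain l where "k = Suc l" using k gr0_implies_Suc by blast
    then show ?thesis by (simp only: sum.lessThan_Suc_shift) simp
  qed
  ultimately show ?thesis by (simp add: layer_0 layer_k)
qed

end

section \<open>Ranks of quotients\<close>

text \<open>Gaussian elimination without division: the pivot \<open>x0\<close> is used to clear coordinate \<open>n\<close> of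
  every other vector.\<close>

lemma integer_dependence:
  fixes v :: "'x \<Rightarrow> nat \<Rightarrow> int"
  assumes "finite X" "n < card X"
  shows "\<exists>c. (\<exists>x\<in>X. c x \<noteq> 0) \<and> (\<forall>i<n. (\<Sum>x\<in>X. c x * v x i) = 0)"
  using assms
proof (induction n arbitrary: X v)
  case 0
  then have "X \<noteq> {}" by auto
  then show ?case by (intro exI[of _ "\<lambda>_. 1"]) auto
next
  case (Suc n)
  show ?case
  proof (cases "\<forall>x\<in>X. v x n = 0")
    case True
    obtain c where "\<exists>x\<in>X. c x \<noteq> 0" "\<forall>i<n. (\<Sum>x\<in>X. c x * v x i) = 0"
      using Suc.IH[of X v] Suc.prems by auto
    then show ?thesis using True by (intro exI[of _ c]) (auto simp: less_Suc_eq)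
  next
    case False
    then obtain x0 where x0: "x0 \<in> X" "v x0 n \<noteq> 0" by blast
    define X' where "X' = X - {x0}"
    have X: "X = insert x0 X'" "x0 \<notin> X'" "finite X'" using x0 Suc.prems by (auto simp: X'_def)
    have "n < card X'" using Suc.prems X by simp
    then obtain c where c: "\<exists>x\<in>X'. c x \<noteq> 0"
        "\<And>i. i < n \<Longrightarrow> (\<Sum>x\<in>X'. c x * (v x0 n * v x i - v x n * v x0 i)) = 0"
      using Suc.IH[of X' "\<lambda>x i. v x0 n * v x i - v x n * v x0 i"] X(3) by blast
    define d where "d x = (if x = x0 then - (\<Sum>x\<in>X'. c x * v x n) else v x0 n * c x)" for x
    have sum: "(\<Sum>x\<in>X. d x * v x i) = (\<Sum>x\<in>X'. c x * (v x0 n * v x i - v x n * v x0 i))" for i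
    proof -
      have "(\<Sum>x\<in>X'. d x * v x i) = (\<Sum>x\<in>X'. v x0 n * c x * v x i)"
        using X(2) by (intro sum.cong) (auto simp: d_def)
      moreover have "(\<Sum>x\<in>X. d x * v x i) = d x0 * v x0 i + (\<Sum>x\<in>X'. d x * v x i)"
        using X by simp
      moreover have "d x0 = - (\<Sum>x\<in>X'. c x * v x n)" by (simp add: d_def)
      ultimately show ?thesis
        by (simp add: right_diff_distrib sum_subtractf sum_distrib_right mult.assoc mult.left_commute)
    qed
    have "(\<Sum>x\<in>X. d x * v x i) = 0" if "i < Suc n" for i
      using that c(2) unfolding sum by (cases "i = n") (auto simp: mult.commute)
    moreover have "\<exists>x\<in>X. d x \<noteq> 0" using c(1) X x0(2) by (auto simp: d_def)
    ultimately show ?thesis by blast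
  qed
qed

section \<open>Linear independence in quotients of integer polynomial rings\<close>

lemma carrier_int_poly_ring:
  "p \<in> carrier (int_poly_ring U) \<longleftrightarrow> (\<forall>m \<in> Poly_Mapping.keys p. Poly_Mapping.keys m \<subseteq> U)"
  by (simp add: int_poly_ring_def)

lemma subring_int_poly: "subring_set (carrier (int_poly_ring U))"
proof -
  interpret cring "int_poly_ring U" by (rule int_poly_ring_cring)
  have "additive_set (carrier (int_poly_ring U))"
    by (auto simp: additive_set_def int_poly_ring_def dest!: subsetD[OF keys_diff])
  moreover have "\<one>\<^bsub>int_poly_ring U\<^esub> = 1" "u \<otimes>\<^bsub>int_poly_ring U\<^esub> v = u * v" for u v
    by (simp_all add: int_poly_ring_def)
  ultimately show ?thesis
    using one_closed m_closed unfolding subring_set_def by metis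
qed

context ideal
begin

lemma coset_eq_zero_iff: "x \<in> carrier R \<Longrightarrow> I +> x = \<zero>\<^bsub>R Quot I\<^esub> \<longleftrightarrow> x \<in> I"
  using a_coset_join1[OF _ _ a_subgroup] a_coset_join2[OF _ a_subgroup] by (auto simp: FactRing_def simp del: a_rcos_zero)

end

text \<open>The rank is defined through integer multiples in the quotient record. Moving them to
  representatives turns a linear relation there into membership of a polynomial in
  \<open>J\<close>.\<close>

lemma pow_quotient_int_poly:
  assumes J: "ideal J (int_poly_ring U)" and p: "p \<in> carrier (int_poly_ring U)"
  shows "of_int c * p \<in> carrier (int_poly_ring U)"
    and "add_pow (int_poly_ring U Quot J) (c::int) (J +>\<^bsub>int_poly_ring U\<^esub> p) =
      J +>\<^bsub>int_poly_ring U\<^esub> (of_int c * p)"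
proof -
  let ?R = "int_poly_ring U"
  interpret cring ?R by (rule int_poly_ring_cring)
  interpret ideal J ?R by (rule J)
  interpret Q: ring "?R Quot J" by (rule quotient_is_ring)
  interpret h: ring_hom_ring ?R "?R Quot J" "(+>\<^bsub>?R\<^esub>) J" by (rule rcos_ring_hom_ring)
  have add: "u \<oplus>\<^bsub>?R\<^esub> v = u + v" for u v by (simp add: int_poly_ring_def)
  have closed: "u + v \<in> carrier ?R" if "u \<in> carrier ?R" "v \<in> carrier ?R" for u v
    using additive_add that subring_int_poly unfolding subring_set_def by blast
  have minus: "- u \<in> carrier ?R" if "u \<in> carrier ?R" for u
    using that by (simp add: int_poly_ring_def)
  have hom0: "J +>\<^bsub>?R\<^esub> 0 = \<zero>\<^bsub>?R Quot J\<^esub>"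
    using h.hom_zero by (simp add: int_poly_ring_def)
  have *: "of_int c * p \<in> carrier ?R \<and> add_pow (?R Quot J) c (J +>\<^bsub>?R\<^esub> p) = J +>\<^bsub>?R\<^esub> (of_int c * p)"
  proof (induction c rule: int_induct[where k = 0])
    case base
    have "0 \<in> carrier ?R" by (simp add: int_poly_ring_def)
    moreover have "add_pow (?R Quot J) (0::int) (J +>\<^bsub>?R\<^esub> p) = \<zero>\<^bsub>?R Quot J\<^esub>"
      by (simp add: add_pow_def)
    ultimately show ?case using hom0 by simp
  next
    case (step1 i)
    have "add_pow (?R Quot J) (i + 1) (J +>\<^bsub>?R\<^esub> p) = (J +>\<^bsub>?R\<^esub> (of_int i * p)) \<oplus>\<^bsub>?R Quot J\<^esub> (J +>\<^bsub>?R\<^esub> p)"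
      using step1 Q.add.int_pow_mult[of "J +>\<^bsub>?R\<^esub> p" i 1] Q.add.int_pow_1[of "J +>\<^bsub>?R\<^esub> p"] p by simp
    also have "\<dots> = J +>\<^bsub>?R\<^esub> (of_int i * p + p)"
      using step1 p h.hom_add[of "of_int i * p" p] by (simp add: add)
    finally show ?case using step1 p closed[of "of_int i * p" p] by (simp add: distrib_right add)
  next
    case (step2 i)
    have "add_pow (?R Quot J) (- 1 :: int) (J +>\<^bsub>?R\<^esub> p) = J +>\<^bsub>?R\<^esub> (- p)"
    proof -
      have "(J +>\<^bsub>?R\<^esub> (- p)) \<oplus>\<^bsub>?R Quot J\<^esub> (J +>\<^bsub>?R\<^esub> p) = \<zero>\<^bsub>?R Quot J\<^esub>"
        using h.hom_add[OF minus[OF p] p] hom0 by (simp add: add)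
      then have "J +>\<^bsub>?R\<^esub> (- p) = \<ominus>\<^bsub>?R Quot J\<^esub> (J +>\<^bsub>?R\<^esub> p)"
        using Q.minus_equality p minus[OF p] by simp
      then show ?thesis
        using Q.add.int_pow_neg[of "J +>\<^bsub>?R\<^esub> p" 1] Q.add.int_pow_1[of "J +>\<^bsub>?R\<^esub> p"] p by (simp add: a_inv_def)
    qed
    then have "add_pow (?R Quot J) (i + - 1) (J +>\<^bsub>?R\<^esub> p) = (J +>\<^bsub>?R\<^esub> (of_int i * p)) \<oplus>\<^bsub>?R Quot J\<^esub> (J +>\<^bsub>?R\<^esub> (- p))"
      using step2 Q.add.int_pow_mult[of "J +>\<^bsub>?R\<^esub> p" i "- 1"] p by simp
    also have "\<dots> = J +>\<^bsub>?R\<^esub> (of_int i * p + - p)"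
      using step2 minus[OF p] h.hom_add[of "of_int i * p" "- p"] by (simp add: add)
    finally show ?case
      using step2 minus[OF p] closed[of "of_int i * p" "- p"] by (simp add: left_diff_distrib add)
  qed
  show "of_int c * p \<in> carrier ?R" "add_pow (?R Quot J) c (J +>\<^bsub>?R\<^esub> p) = J +>\<^bsub>?R\<^esub> (of_int c * p)"
    using * by simp_all
qed

text \<open>A basis of the quotient gives \<open>n\<close> independent classes. Conversely, more
  than \<open>n\<close> classes, expressed in this basis, satisfy an integer relation by
  \<open>integer_dependence\<close>.\<close>

lemma rank_quotient_int_poly:
  assumes J: "ideal J (int_poly_ring U)" and fr: "free_rank (carrier (int_poly_ring U)) J n"
  shows "ab_group_rank (add_monoid (int_poly_ring U Quot J)) = n"
proof -
  let ?R = "int_poly_ring U"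
  let ?A = "carrier ?R"
  define \<pi> where "\<pi> = (+>\<^bsub>?R\<^esub>) J"
  interpret cring ?R by (rule int_poly_ring_cring)
  interpret ideal J ?R by (rule J)
  interpret Q: ring "?R Quot J" by (rule quotient_is_ring)
  interpret h: ring_hom_ring ?R "?R Quot J" \<pi> unfolding \<pi>_def by (rule rcos_ring_hom_ring)
  have add: "u \<oplus>\<^bsub>?R\<^esub> v = u + v" and zero: "\<zero>\<^bsub>?R\<^esub> = 0" for u v by (simp_all add: int_poly_ring_def)
  have addA: "additive_set ?A" using subring_int_poly unfolding subring_set_def by blast
  have mem: "\<pi> p = \<zero>\<^bsub>?R Quot J\<^esub> \<longleftrightarrow> p \<in> J" if "p \<in> ?A" for p
    unfolding \<pi>_def using coset_eq_zero_iff[OF that] by simp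
  have comb: "finsum (?R Quot J) (\<lambda>i. add_pow (?R Quot J) ((c i :: int)) (\<pi> (f i))) X = \<pi> (\<Sum>i\<in>X. of_int (c i) * f i)"
    if "finite X" "\<And>i. i \<in> X \<Longrightarrow> f i \<in> ?A" for X :: "'x set" and f c
    using that
  proof (induction X rule: finite_induct)
    case empty
    then show ?case using h.hom_zero by (simp add: zero)
  next
    case (insert x X)
    have "(\<Sum>i\<in>X. of_int (c i) * f i) \<in> ?A"
      using insert by (intro additive_sum addA pow_quotient_int_poly(1)[OF J]) auto
    moreover have "add_pow (?R Quot J) ((c i)) (\<pi> (f i)) = \<pi> (of_int (c i) * f i)" "of_int (c i) * f i \<in> ?A"
      if "i \<in> insert x X" for i
      using pow_quotient_int_poly[OF J, of "f i"] insert.prems that by (auto simp: \<pi>_def)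
    ultimately show ?case
      using insert h.hom_add[of "of_int (c x) * f x" "\<Sum>i\<in>X. of_int (c i) * f i"] Q.add.finprod_insert[of X x]
      by (simp add: Pi_def add)
  qed
  obtain e where e: "\<And>i. i < n \<Longrightarrow> e i \<in> ?A"
      "\<And>p. p \<in> ?A \<Longrightarrow> \<exists>c. p - (\<Sum>i<n. of_int (c i) * e i) \<in> J"
      "\<And>c. (\<Sum>i<n. of_int (c i) * e i) \<in> J \<Longrightarrow> \<forall>i<n. c i = 0"
    using fr unfolding free_rank_def by blast
  have addJ: "additive_set J"
    unfolding additive_set_def
  proof (intro conjI ballI)
    show "0 \<in> J" using additive_subgroup.zero_closed[OF additive_subgroup_axioms] by (simp add: zero)
    fix p q assume "p \<in> J" "q \<in> J"
    have "q \<in> ?A" using \<open>q \<in> J\<close> by (rule a_Hcarr)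
    then have "\<ominus>\<^bsub>?R\<^esub> q = - q"
      by (intro minus_equality) (simp_all add: add zero, simp add: int_poly_ring_def)
    then have "- q \<in> J" using additive_subgroup.a_inv_closed[OF additive_subgroup_axioms \<open>q \<in> J\<close>] by simp
    then have "p \<oplus>\<^bsub>?R\<^esub> (- q) \<in> J"
      using \<open>p \<in> J\<close> additive_subgroup.a_closed[OF additive_subgroup_axioms] by blast
    then show "p - q \<in> J" by (simp add: add)
  qed
  let ?indep = "\<lambda>X. \<forall>c :: _ \<Rightarrow> int. finsum (?R Quot J) (\<lambda>x. add_pow (?R Quot J) (c x) x) X = \<zero>\<^bsub>?R Quot J\<^esub> \<longrightarrow> (\<forall>x\<in>X. c x = 0)"
  have upper: "card X \<le> n" if X: "finite X" "X \<subseteq> carrier (?R Quot J)" "?indep X" for X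
  proof (rule ccontr)
    assume "\<not> card X \<le> n"
    have "\<forall>x\<in>X. \<exists>p\<in>?A. \<pi> p = x"
      using X(2) by (auto simp: FactRing_def A_RCOSETS_def' \<pi>_def)
    then obtain \<rho> where \<rho>: "\<And>x. x \<in> X \<Longrightarrow> \<rho> x \<in> ?A" "\<And>x. x \<in> X \<Longrightarrow> \<pi> (\<rho> x) = x" by metis
    have "\<forall>x\<in>X. \<exists>v. \<rho> x - (\<Sum>i<n. of_int (v i) * e i) \<in> J" using \<rho>(1) e(2) by blast
    then obtain v where v: "\<And>x. x \<in> X \<Longrightarrow> \<rho> x - (\<Sum>i<n. of_int (v x i) * e i) \<in> J" by metis
    obtain c where c: "\<exists>x\<in>X. c x \<noteq> 0" "\<And>i. i < n \<Longrightarrow> (\<Sum>x\<in>X. c x * v x i) = 0"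
      using integer_dependence[OF X(1), of n v] \<open>\<not> card X \<le> n\<close> by auto
    have "(\<Sum>x\<in>X. of_int (c x) * (\<rho> x - (\<Sum>i<n. of_int (v x i) * e i))) \<in> J"
      using v by (intro additive_sum additive_of_int_mult addJ)
    moreover have "(\<Sum>x\<in>X. of_int (c x) * (\<Sum>i<n. of_int (v x i) * e i)) =
        (\<Sum>i<n. of_int (\<Sum>x\<in>X. c x * v x i) * e i)"
      unfolding sum_distrib_left
      by (subst sum.swap) (simp add: sum_distrib_right mult.assoc)
    ultimately have "(\<Sum>x\<in>X. of_int (c x) * \<rho> x) \<in> J"
      using c(2) by (simp add: right_diff_distrib sum_subtractf)
    moreover have "(\<Sum>x\<in>X. of_int (c x) * \<rho> x) \<in> ?A"
      using \<rho>(1) by (intro additive_sum addA pow_quotient_int_poly(1)[OF J])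
    moreover have "finsum (?R Quot J) (\<lambda>x. add_pow (?R Quot J) (c x) x) X = finsum (?R Quot J) (\<lambda>x. add_pow (?R Quot J) (c x) (\<pi> (\<rho> x))) X"
      using X(2) \<rho>(2) by (intro Q.add.finprod_cong') auto
    ultimately have "finsum (?R Quot J) (\<lambda>x. add_pow (?R Quot J) (c x) x) X = \<zero>\<^bsub>?R Quot J\<^esub>"
      using comb[OF X(1), of \<rho> c] \<rho>(1) mem by simp
    then show False using X(3) c(1) by blast
  qed
  \<comment> \<open>The rank counts elements of sets, so the basis classes must be distinct: a
    coincidence would put \<open>e i - e j\<close> into \<open>J\<close>.\<close>
  have inj: "inj_on (\<lambda>i. \<pi> (e i)) {..<n}"
  proof (rule inj_onI, rule ccontr)
    fix i j assume ij: "i \<in> {..<n}" "j \<in> {..<n}" "\<pi> (e i) = \<pi> (e j)" "i \<noteq> j"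
    define c where "c l = (if l = i then 1 else if l = j then - 1 else 0 :: int)" for l
    have "finsum (?R Quot J) (\<lambda>l. add_pow (?R Quot J) (c l) (\<pi> (e l))) {i, j} = \<zero>\<^bsub>?R Quot J\<^esub>"
    proof -
      have "finsum (?R Quot J) (\<lambda>l. add_pow (?R Quot J) (c l) (\<pi> (e l))) {i, j} =
          add_pow (?R Quot J) ((1::int)) (\<pi> (e i)) \<oplus>\<^bsub>?R Quot J\<^esub> add_pow (?R Quot J) ((- 1 :: int)) (\<pi> (e i))"
        using ij e(1) Q.add.finprod_insert[of "{j}" i "\<lambda>l. add_pow (?R Quot J) (c l) (\<pi> (e l))"]
        by (simp add: c_def Pi_def)
      also have "\<dots> = \<zero>\<^bsub>?R Quot J\<^esub>"
        using Q.add.int_pow_mult[of "\<pi> (e i)" 1 "-1"] ij e(1)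
        by (simp add: add_pow_def[of _ "0::int"])
      finally show ?thesis .
    qed
    then have "\<pi> (\<Sum>l\<in>{i, j}. of_int (c l) * e l) = \<zero>\<^bsub>?R Quot J\<^esub>"
      using comb[of "{i, j}" e c] ij e(1) by auto
    moreover have "(\<Sum>l\<in>{i, j}. of_int (c l) * e l) \<in> ?A"
      using ij e(1) by (intro additive_sum addA pow_quotient_int_poly(1)[OF J]) auto
    moreover have "(\<Sum>l<n. of_int (c l) * e l) = (\<Sum>l\<in>{i, j}. of_int (c l) * e l)"
      using ij by (intro sum.mono_neutral_right) (auto simp: c_def)
    ultimately have "(\<Sum>l<n. of_int (c l) * e l) \<in> J" using mem by simp
    then have "c i = 0" using e(3) ij by blast
    then show False by (simp add: c_def)
  qed
  let ?E = "(\<lambda>i. \<pi> (e i)) ` {..<n}"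
  have E: "finite ?E" "?E \<subseteq> carrier (?R Quot J)" "card ?E = n"
    using e(1) card_image[OF inj] by auto
  have indep: "?indep ?E"
  proof (intro allI impI)
    fix c :: "_ \<Rightarrow> int" assume *: "finsum (?R Quot J) (\<lambda>x. add_pow (?R Quot J) (c x) x) ?E = \<zero>\<^bsub>?R Quot J\<^esub>"
    have "finsum (?R Quot J) (\<lambda>x. add_pow (?R Quot J) (c x) x) ?E = finsum (?R Quot J) (\<lambda>i. add_pow (?R Quot J) (c (\<pi> (e i))) (\<pi> (e i))) {..<n}"
      using E(2) by (intro Q.add.finprod_reindex[OF _ inj]) auto
    also have "\<dots> = \<pi> (\<Sum>i<n. of_int (c (\<pi> (e i))) * e i)"
      using comb[of "{..<n}" e "\<lambda>i. c (\<pi> (e i))"] e(1) by auto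
    finally have "\<pi> (\<Sum>i<n. of_int (c (\<pi> (e i))) * e i) = \<zero>\<^bsub>?R Quot J\<^esub>"
      using * by simp
    moreover have "(\<Sum>i<n. of_int (c (\<pi> (e i))) * e i) \<in> ?A"
      using e(1) by (intro additive_sum addA pow_quotient_int_poly(1)[OF J]) auto
    ultimately have "(\<Sum>i<n. of_int (c (\<pi> (e i))) * e i) \<in> J"
      using mem by blast
    then show "\<forall>x\<in>?E. c x = 0" using e(3)[of "\<lambda>i. c (\<pi> (e i))"] by auto
  qed
  show ?thesis
    unfolding ab_group_rank_def finsum_def[symmetric] add_pow_def[symmetric] monoid.simps partial_object.simps
  proof (rule cSup_eq_maximum)
    show "n \<in> {card X |X. finite X \<and> X \<subseteq> carrier (?R Quot J) \<and> ?indep X}"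
      by (rule CollectI, rule exI[of _ ?E], intro conjI) (use E indep in simp_all)
    show "m \<le> n" if "m \<in> {card X |X. finite X \<and> X \<subseteq> carrier (?R Quot J) \<and> ?indep X}" for m
      using that upper by (elim CollectE exE conjE) simp
  qed
qed

section \<open>Polynomials in one more variable\<close>

lemma var_in_carrier: "g \<in> U \<Longrightarrow> var g \<in> carrier (int_poly_ring U)"
  by (simp add: carrier_int_poly_ring var_def)

lemma carrier_int_poly_mono:
  "U \<subseteq> V \<Longrightarrow> carrier (int_poly_ring U) \<subseteq> carrier (int_poly_ring V)"
  unfolding carrier_int_poly_ring subset_iff by blast

lemma var_power: "var g ^ j = Poly_Mapping.single (Poly_Mapping.single g j) 1"
  by (induction j) (simp_all add: var_def mult_single single_add[symmetric])

lemma sum_singles: "(\<Sum>m\<in>Poly_Mapping.keys p. Poly_Mapping.single m (Poly_Mapping.lookup p m)) = p"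
proof (rule poly_mapping_eqI)
  fix k
  show "Poly_Mapping.lookup (\<Sum>m\<in>Poly_Mapping.keys p. Poly_Mapping.single m (Poly_Mapping.lookup p m)) k =
      Poly_Mapping.lookup p k"
    by (auto simp: lookup_sum lookup_single when_def in_keys_iff sum.delta[OF finite_keys])
qed

text \<open>A monomial factors uniquely into a power of \<open>M\<close> and a monomial free of
  \<open>M\<close>. As \<open>M\<close> does not occur in \<open>p\<close>, multiplying by
  \<open>var M ^ j\<close> shifts the monomials of \<open>p\<close> without collision.\<close>

lemma lookup_mult_var_power:
  assumes p: "p \<in> carrier (int_poly_ring U)" and M: "M \<notin> U" and m: "Poly_Mapping.lookup m M = 0"
  shows "Poly_Mapping.lookup (p * var M ^ j) (m + Poly_Mapping.single M i) =
    (if i = j then Poly_Mapping.lookup p m else 0)"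
proof -
  have "p * var M ^ j =
      (\<Sum>k\<in>Poly_Mapping.keys p. Poly_Mapping.single (k + Poly_Mapping.single M j) (Poly_Mapping.lookup p k))"
    by (subst sum_singles[of p, symmetric])
      (simp only: sum_distrib_right var_power mult_single mult_1_right)
  moreover have "(k + Poly_Mapping.single M j = m + Poly_Mapping.single M i) \<longleftrightarrow> k = m \<and> i = j"
    if "k \<in> Poly_Mapping.keys p" for k
  proof
    assume *: "k + Poly_Mapping.single M j = m + Poly_Mapping.single M i"
    have "Poly_Mapping.lookup k M = 0"
      using p M that by (meson carrier_int_poly_ring in_keys_iff subsetD)
    moreover have "Poly_Mapping.lookup (k + Poly_Mapping.single M j) M =
        Poly_Mapping.lookup (m + Poly_Mapping.single M i) M" using * by simp
    ultimately have "i = j" using m by (simp add: lookup_add)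
    then show "k = m \<and> i = j" using * by simp
  qed simp
  ultimately have "Poly_Mapping.lookup (p * var M ^ j) (m + Poly_Mapping.single M i) =
      (\<Sum>k\<in>Poly_Mapping.keys p. if k = m \<and> i = j then Poly_Mapping.lookup p k else 0)"
    by (simp add: lookup_sum lookup_single when_def cong: sum.cong)
  also have "\<dots> = (if i = j then Poly_Mapping.lookup p m else 0)"
    by (auto simp: in_keys_iff sum.delta[OF finite_keys])
  finally show ?thesis .
qed

text \<open>\<open>var M\<close> is transcendental over \<open>Pol U\<close>: for \<open>m\<close>
  free of \<open>M\<close>, the \<open>m\<close>-coefficient of \<open>coeff q i\<close> reappears
  in \<open>poly q (var M)\<close> at the monomial \<open>m\<close> times the \<open>i\<close>-th
  power of \<open>M\<close>.\<close>

lemma poly_var_eq_0: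
  assumes q: "q \<in> polys_over (carrier (int_poly_ring U))" and M: "M \<notin> U" and 0: "poly q (var M) = 0"
  shows "q = 0"
proof (rule poly_eqI)
  fix i
  have "Poly_Mapping.lookup (coeff q i) m = 0" for m
  proof (cases "Poly_Mapping.lookup m M = 0")
    case True
    have "0 = Poly_Mapping.lookup (\<Sum>j\<le>degree q. coeff q j * var M ^ j) (m + Poly_Mapping.single M i)"
      using 0 by (simp add: poly_altdef)
    also have "\<dots> = (\<Sum>j\<le>degree q. if i = j then Poly_Mapping.lookup (coeff q j) m else 0)"
      by (simp add: lookup_sum lookup_mult_var_power[OF polys_overD[OF q] M True])
    also have "\<dots> = Poly_Mapping.lookup (coeff q i) m"
      by (simp add: coeff_eq_0)
    finally show ?thesis by simp
  next
    case False
    then have "M \<in> Poly_Mapping.keys m" by (simp add: in_keys_iff)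
    then have "\<not> Poly_Mapping.keys m \<subseteq> U" using M by blast
    then show ?thesis using polys_overD[OF q, of i] by (auto simp: carrier_int_poly_ring in_keys_iff)
  qed
  then show "coeff q i = coeff 0 i" by (simp add: poly_mapping_eqI)
qed

text \<open>For \<open>M \<notin> U\<close> this and \<open>poly_var_eq_0\<close> identify
  \<open>(Pol U)[x]\<close> with \<open>Pol (insert M U)\<close>, sending \<open>x\<close> to
  \<open>var M\<close>. The abstract blow-up formula reaches the polynomial rings of the theorem
  along this identification.\<close>

lemma poly_var_image:
  "(\<lambda>q. poly q (var M)) ` polys_over (carrier (int_poly_ring U)) = carrier (int_poly_ring (insert M U))"
proof
  let ?A = "carrier (int_poly_ring U)" and ?B = "carrier (int_poly_ring (insert M U))"
  have A: "additive_set ?A" and B: "additive_set ?B" "\<And>a b. a \<in> ?B \<Longrightarrow> b \<in> ?B \<Longrightarrow> a * b \<in> ?B" "1 \<in> ?B"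
    using subring_int_poly by (auto simp: subring_set_def)
  have pow: "var M ^ j \<in> ?B" for j
    by (induction j) (simp_all add: B var_in_carrier)
  have "?A \<subseteq> ?B" by (rule carrier_int_poly_mono) blast
  then show "(\<lambda>q. poly q (var M)) ` polys_over ?A \<subseteq> ?B"
    using pow by (auto simp: poly_altdef intro!: additive_sum[OF B(1)] B(2) dest: polys_overD)
  have single: "\<exists>q \<in> polys_over ?A. Poly_Mapping.single m c = poly q (var M)"
    if "Poly_Mapping.keys m \<subseteq> insert M U" for m c
  proof
    define j where "j = Poly_Mapping.lookup m M"
    define m' where "m' = m - Poly_Mapping.single M j"
    have m: "m = m' + Poly_Mapping.single M j"
      by (rule poly_mapping_eqI) (auto simp: m'_def j_def lookup_add lookup_minus lookup_single when_def)
    have "Poly_Mapping.keys m' \<subseteq> U"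
    proof
      fix x assume "x \<in> Poly_Mapping.keys m'"
      then have "Poly_Mapping.lookup m x \<noteq> 0" "x \<noteq> M"
        by (auto simp: in_keys_iff m'_def j_def lookup_minus lookup_single when_def split: if_splits)
      then have "x \<in> Poly_Mapping.keys m" "x \<noteq> M" by (simp_all add: in_keys_iff)
      then show "x \<in> U" using that by blast
    qed
    then show "monom (Poly_Mapping.single m' c) j \<in> polys_over ?A"
      using additive_zero[OF A] by (auto simp: polys_over_def carrier_int_poly_ring)
    show "Poly_Mapping.single m c = poly (monom (Poly_Mapping.single m' c) j) (var M)"
      by (simp add: poly_monom var_power mult_single m)
  qed
  show "?B \<subseteq> (\<lambda>q. poly q (var M)) ` polys_over ?A"
  proof
    fix p assume p: "p \<in> ?B"
    have "\<forall>m \<in> Poly_Mapping.keys p. \<exists>q. q \<in> polys_over ?A \<and>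
        Poly_Mapping.single m (Poly_Mapping.lookup p m) = poly q (var M)"
      using p single unfolding carrier_int_poly_ring by blast
    then obtain q where q: "\<And>m. m \<in> Poly_Mapping.keys p \<Longrightarrow> q m \<in> polys_over ?A \<and>
        Poly_Mapping.single m (Poly_Mapping.lookup p m) = poly (q m) (var M)"
      by metis
    have "p = (\<Sum>m\<in>Poly_Mapping.keys p. Poly_Mapping.single m (Poly_Mapping.lookup p m))"
      by (simp add: sum_singles)
    also have "\<dots> = (\<Sum>m\<in>Poly_Mapping.keys p. poly (q m) (var M))" using q by simp
    also have "\<dots> = poly (\<Sum>m\<in>Poly_Mapping.keys p. q m) (var M)" by (simp add: poly_sum)
    finally show "p \<in> (\<lambda>q. poly q (var M)) ` polys_over ?A"
      using q by (auto intro!: imageI additive_sum additive_polys_over A)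
  qed
qed

section \<open>Generated ideals\<close>

abbreviation Pol :: "'a set \<Rightarrow> 'a int_poly set" where
  "Pol U \<equiv> carrier (int_poly_ring U)"

text \<open>The generated ideal as an inductive set of finite sums: its induction reduces an
  inclusion to multiples \<open>a * s\<close> of generators.\<close>

inductive_set idl :: "'a set \<Rightarrow> 'a int_poly set \<Rightarrow> 'a int_poly set" for U S where
  zero: "0 \<in> idl U S"
| step: "p \<in> idl U S \<Longrightarrow> a \<in> Pol U \<Longrightarrow> s \<in> S \<Longrightarrow> p + a * s \<in> idl U S"

lemma additive_Pol: "additive_set (Pol U)"
  and Pol_1: "1 \<in> Pol U"
  and Pol_mult: "p \<in> Pol U \<Longrightarrow> q \<in> Pol U \<Longrightarrow> p * q \<in> Pol U"
  using subring_int_poly unfolding subring_set_def by blast+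

lemma Pol_power: "p \<in> Pol U \<Longrightarrow> p ^ n \<in> Pol U"
  by (induction n) (simp_all only: power_0 power_Suc Pol_1 Pol_mult)

lemma Pol_prod: "(\<And>x. x \<in> X \<Longrightarrow> f x \<in> Pol U) \<Longrightarrow> prod f X \<in> Pol U"
proof (induction X rule: infinite_finite_induct)
  case (insert x X)
  then have "f x * prod f X \<in> Pol U" by (intro Pol_mult) auto
  then show ?case using insert.hyps by simp
qed (simp_all add: Pol_1)

text \<open>\<open>T\<close> need only be additive. Through \<open>D_ideal_least\<close> it becomes
  a set such as \<open>{j. z ^ k * j \<in> D_ideal U I}\<close> or the image of an ideal under
  evaluation.\<close>

lemma idl_least:
  assumes "additive_set T" "\<And>a s. a \<in> Pol U \<Longrightarrow> s \<in> S \<Longrightarrow> a * s \<in> T"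
  shows "idl U S \<subseteq> T"
proof
  fix p assume "p \<in> idl U S"
  then show "p \<in> T"
    by induction (simp_all add: assms additive_zero additive_add)
qed

lemma idl_gen: "s \<in> S \<Longrightarrow> s \<in> idl U S"
  using idl.step[OF idl.zero Pol_1] by fastforce

lemma ideal_idl:
  assumes "S \<subseteq> Pol U"
  shows "ideal_set (Pol U) (idl U S)"
proof -
  have uminus: "- p \<in> idl U S" if "p \<in> idl U S" for p
    using that
  proof induction
    case (step p a s)
    have "- p + (- a) * s \<in> idl U S"
      using step additive_uminus[OF additive_Pol] by (intro idl.step) auto
    then show ?case by simp
  qed (simp add: idl.zero)
  have add: "p + q \<in> idl U S" if p: "p \<in> idl U S" and q: "q \<in> idl U S" for p q
    using q
  proof induction
    case (step q a s)
    have "(p + q) + a * s \<in> idl U S" using step by (intro idl.step) auto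
    then show ?case by (simp add: add.assoc)
  qed (simp add: p)
  have "additive_set (idl U S)"
    unfolding additive_set_def using add uminus idl.zero by (metis diff_conv_add_uminus)
  moreover have "idl U S \<subseteq> Pol U"
    using assms by (intro idl_least additive_Pol Pol_mult) auto
  moreover have "b * p \<in> idl U S" if "p \<in> idl U S" "b \<in> Pol U" for b p
    using that
  proof induction
    case (step p a s)
    have "b * p + (b * a) * s \<in> idl U S"
      using step Pol_mult by (intro idl.step) auto
    then show ?case by (simp add: algebra_simps)
  qed (simp add: idl.zero)
  ultimately show ?thesis by (simp add: ideal_set_def)
qed

lemma ideal_set_imp_ideal:
  assumes "ideal_set (Pol U) J"
  shows "ideal J (int_poly_ring U)"
proof (rule idealI)
  interpret cring "int_poly_ring U" by (rule int_poly_ring_cring)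
  have ops: "\<zero>\<^bsub>int_poly_ring U\<^esub> = 0" "p \<oplus>\<^bsub>int_poly_ring U\<^esub> q = p + q" "p \<otimes>\<^bsub>int_poly_ring U\<^esub> q = p * q" for p q
    by (simp_all add: int_poly_ring_def)
  show "ring (int_poly_ring U)" by (rule ring_axioms)
  have J: "additive_set J" "J \<subseteq> Pol U" "\<And>a j. a \<in> Pol U \<Longrightarrow> j \<in> J \<Longrightarrow> a * j \<in> J"
    using assms by (auto simp: ideal_set_def)
  have "\<ominus>\<^bsub>int_poly_ring U\<^esub> p = - p" if "p \<in> J" for p
    using that J(2) additive_uminus[OF J(1)]
    by (intro minus_equality) (auto simp: ops)
  then show "subgroup J (add_monoid (int_poly_ring U))"
    using J additive_uminus[OF J(1)] additive_zero[OF J(1)]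
    by (intro add.subgroupI) (auto simp: ops additive_add)
  show "p \<otimes>\<^bsub>int_poly_ring U\<^esub> q \<in> J" "q \<otimes>\<^bsub>int_poly_ring U\<^esub> p \<in> J"
    if "q \<in> J" "p \<in> Pol U" for p q
    using J(3)[OF that(2,1)] by (simp_all add: ops mult.commute)
qed

lemma ideal_imp_ideal_set:
  assumes "ideal J (int_poly_ring U)"
  shows "ideal_set (Pol U) J"
proof -
  interpret cring "int_poly_ring U" by (rule int_poly_ring_cring)
  interpret ideal J "int_poly_ring U" by (rule assms)
  have ops: "\<zero>\<^bsub>int_poly_ring U\<^esub> = 0" "p \<oplus>\<^bsub>int_poly_ring U\<^esub> q = p + q" "p \<otimes>\<^bsub>int_poly_ring U\<^esub> q = p * q" for p q
    by (simp_all add: int_poly_ring_def)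
  have sub: "J \<subseteq> Pol U" using a_subset .
  have mult: "a * j \<in> J" if "a \<in> Pol U" "j \<in> J" for a j
    using I_l_closed[OF that(2,1)] by (simp add: ops)
  have "p - q \<in> J" if "p \<in> J" "q \<in> J" for p q
  proof -
    have "- 1 \<in> Pol U" using additive_uminus[OF additive_Pol Pol_1] .
    then have "- 1 * q \<in> J" using that by (intro mult)
    then have "p \<oplus>\<^bsub>int_poly_ring U\<^esub> (- 1 * q) \<in> J"
      using that(1) additive_subgroup.a_closed[OF additive_subgroup_axioms] by blast
    then show ?thesis by (simp add: ops)
  qed
  moreover have "0 \<in> J" using additive_subgroup.zero_closed[OF additive_subgroup_axioms] by (simp add: ops)
  ultimately show ?thesis using sub mult by (simp add: ideal_set_def additive_set_def)
qed

lemma genideal_eq_idl: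
  assumes "S \<subseteq> Pol U"
  shows "Idl\<^bsub>int_poly_ring U\<^esub> S = idl U S"
proof
  interpret cring "int_poly_ring U" by (rule int_poly_ring_cring)
  show "Idl\<^bsub>int_poly_ring U\<^esub> S \<subseteq> idl U S"
    using ideal_set_imp_ideal[OF ideal_idl[OF assms]] by (rule genideal_minimal) (auto intro: idl_gen)
  show "idl U S \<subseteq> Idl\<^bsub>int_poly_ring U\<^esub> S"
    using ideal_imp_ideal_set[OF genideal_ideal[OF assms]] genideal_self[OF assms]
    by (intro idl_least) (auto simp: ideal_set_def)
qed

text \<open>\<open>I\<close> need not lie in \<open>U\<close>: an element of \<open>I\<close>
  outside \<open>U\<close> has no variable in the ring but can still lower the defects of the
  elements above it. A center \<open>insert M I\<close> with \<open>M \<notin> U\<close> is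
  described in this way.\<close>

definition D_ideal :: "'a::{finite, complete_lattice} set \<Rightarrow> 'a set \<Rightarrow> 'a int_poly set" where
  "D_ideal U I = idl U (D_relations U I)"

lemma ideal_D_ideal: "ideal_set (Pol U) (D_ideal U I)"
  unfolding D_ideal_def by (rule ideal_idl[OF D_relations_subset_carrier])

lemma additive_D_ideal: "additive_set (D_ideal U I)"
  and D_ideal_subset: "D_ideal U I \<subseteq> Pol U"
  and D_ideal_mult: "a \<in> Pol U \<Longrightarrow> j \<in> D_ideal U I \<Longrightarrow> a * j \<in> D_ideal U I"
  using ideal_D_ideal[of U I] by (auto simp: ideal_set_def)

lemma chi_arr_eq:
  assumes "free_rank (Pol U) (D_ideal U I) n"
  shows "chi_arr U I = int n"
  using rank_quotient_int_poly[OF ideal_set_imp_ideal[OF ideal_D_ideal] assms]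
  by (simp add: chi_arr_def D_ring_def D_ideal_def genideal_eq_idl[OF D_relations_subset_carrier])

section \<open>Atom defects and relations\<close>

lemma atom_defect_le:
  fixes B :: "'a::{finite, complete_lattice}"
  assumes "A \<subseteq> atoms" "B = Sup (H \<union> {y \<in> S. y < B} \<union> A)"
  shows "atom_defect S H B \<le> card A"
  unfolding atom_defect_def using assms by (intro Least_le) blast

lemma atom_defect_attained:
  fixes B :: "'a::{finite, complete_lattice}"
  assumes at: "atomic TYPE('a)" and H: "\<And>h. h \<in> H \<Longrightarrow> h \<le> B"
  obtains A where "A \<subseteq> atoms" "card A = atom_defect S H B" "B = Sup (H \<union> {y \<in> S. y < B} \<union> A)"
proof -
  obtain T where "T \<subseteq> atoms" "B = Sup T" using at unfolding atomic_def by blast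
  moreover have "Sup (H \<union> {y \<in> S. y < B} \<union> T) = B"
    using H \<open>B = Sup T\<close> by (intro antisym Sup_least) (auto intro: Sup_subset_mono Sup_upper less_imp_le)
  ultimately have "\<exists>m. \<exists>A \<subseteq> atoms. card A = m \<and> B = Sup (H \<union> {y \<in> S. y < B} \<union> A)" by metis
  then have "\<exists>A \<subseteq> atoms. card A = atom_defect S H B \<and> B = Sup (H \<union> {y \<in> S. y < B} \<union> A)"
    unfolding atom_defect_def by (rule LeastI_ex)
  then show thesis using that by blast
qed

text \<open>Atoms that complete \<open>H\<close> and \<open>S\<close> below \<open>B\<close> to
  \<open>B\<close> also complete the primed data to \<open>B'\<close>: their join with the primed
  data contains \<open>B\<close>, hence \<open>B'\<close>. Allowing \<open>B' \<noteq> B\<close>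
  makes it possible to move relations up to a join.\<close>

lemma atom_defect_le_transfer:
  fixes B :: "'a::{finite, complete_lattice}"
  assumes at: "atomic TYPE('a)" and H: "\<And>h. h \<in> H \<Longrightarrow> h \<le> B" and H': "\<And>h. h \<in> H' \<Longrightarrow> h \<le> B'"
    and "B \<le> B'" "B' \<le> sup B (Sup (H' \<union> {y \<in> S'. y < B'}))"
    and sub: "\<And>y. y \<in> H \<or> y \<in> S \<and> y < B \<Longrightarrow> y \<le> Sup (H' \<union> {y \<in> S'. y < B'})"
  shows "atom_defect S' H' B' \<le> atom_defect S H B"
proof -
  obtain A where A: "A \<subseteq> atoms" "card A = atom_defect S H B" "B = Sup (H \<union> {y \<in> S. y < B} \<union> A)"
    using atom_defect_attained[OF at H] by blast
  let ?X = "H' \<union> {y \<in> S'. y < B'}"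
  have le: "Sup ?X \<le> Sup (?X \<union> A)" by (intro Sup_subset_mono) auto
  have "Sup (H \<union> {y \<in> S. y < B} \<union> A) \<le> Sup (?X \<union> A)"
    using sub le by (intro Sup_least) (auto intro: Sup_upper order_trans)
  then have "B \<le> Sup (?X \<union> A)" using A(3) by simp
  then have "B' \<le> Sup (?X \<union> A)" using assms(5) le by (meson order_trans sup_least)
  moreover have "a \<le> B'" if "a \<in> A" for a
  proof -
    have "a \<le> Sup (H \<union> {y \<in> S. y < B} \<union> A)" using that by (intro Sup_upper) auto
    then show ?thesis using A(3) assms(4) by (metis order_trans)
  qed
  then have "Sup (?X \<union> A) \<le> B'"
    using H' by (intro Sup_least) auto
  ultimately have "B' = Sup (H' \<union> {y \<in> S'. y < B'} \<union> A)" by (rule antisym)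
  from atom_defect_le[OF A(1) this] show ?thesis by (simp add: A(2))
qed

text \<open>Atoms producing \<open>M\<close> from \<open>S\<close>, added to atoms producing
  \<open>B\<close> from \<open>insert M S\<close>, produce \<open>B\<close> from \<open>S\<close>.
  This bounds the exponent when a relation of the center is multiplied by
  \<open>z ^ k\<close>.\<close>

lemma atom_defect_triangle:
  fixes B :: "'a::{finite, complete_lattice}"
  assumes at: "atomic TYPE('a)" and H: "\<And>h. h \<in> H \<Longrightarrow> h \<le> B" and "M < B"
  shows "atom_defect S H B \<le> atom_defect (insert M S) H B + atom_defect S {} M"
proof -
  obtain A where A: "A \<subseteq> atoms" "card A = atom_defect (insert M S) H B"
      "B = Sup (H \<union> {y \<in> insert M S. y < B} \<union> A)"
    using atom_defect_attained[OF at H] by blast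
  obtain A' where A': "A' \<subseteq> atoms" "card A' = atom_defect S {} M" "M = Sup ({} \<union> {y \<in> S. y < M} \<union> A')"
    using atom_defect_attained[OF at, of "{}" M S] by blast
  let ?X = "H \<union> {y \<in> S. y < B} \<union> (A \<union> A')"
  have "M = Sup ({y \<in> S. y < M} \<union> A')" using A'(3) by simp
  also have "\<dots> \<le> Sup ?X" using \<open>M < B\<close> by (intro Sup_subset_mono) auto
  finally have M: "M \<le> Sup ?X" .
  have "Sup (H \<union> {y \<in> insert M S. y < B} \<union> A) \<le> Sup ?X"
    using M by (intro Sup_least) (auto intro: Sup_upper)
  then have "B \<le> Sup ?X" using A(3) by simp
  moreover have "a \<le> B" if "a \<in> A" for a
  proof -
    have "a \<le> Sup (H \<union> {y \<in> insert M S. y < B} \<union> A)" using that by (intro Sup_upper) auto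
    then show ?thesis using A(3) by metis
  qed
  moreover have "a \<le> B" if "a \<in> A'" for a
  proof -
    have "a \<le> Sup ({} \<union> {y \<in> S. y < M} \<union> A')" using that by (intro Sup_upper) auto
    then show ?thesis using A'(3) \<open>M < B\<close> by (metis less_imp_le order_trans)
  qed
  ultimately have "B = Sup ?X" using H by (intro antisym Sup_least) auto
  then have "atom_defect S H B \<le> card (A \<union> A')" using A(1) A'(1) by (intro atom_defect_le) auto
  also have "\<dots> \<le> card A + card A'" by (rule card_Un_le)
  finally show ?thesis by (simp add: A(2) A'(2))
qed

section \<open>Generators of the relation ideals and their dependence on \<open>I\<close>\<close>

definition upper_sum :: "'a::{finite, complete_lattice} set \<Rightarrow> 'a \<Rightarrow> 'a int_poly" where
  "upper_sum U B = (\<Sum>C\<in>{C \<in> U. B \<le> C}. var C)"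

definition rel :: "'a::{finite, complete_lattice} set \<Rightarrow> 'a set \<Rightarrow> 'a \<Rightarrow> nat \<Rightarrow> 'a int_poly" where
  "rel U H B m = (\<Prod>A\<in>H. var A) * upper_sum U B ^ m"

lemma upper_sum_Pol: "upper_sum U B \<in> Pol U"
  unfolding upper_sum_def by (intro additive_sum additive_Pol var_in_carrier) auto

lemma prod_var_Pol: "H \<subseteq> U \<Longrightarrow> (\<Prod>A\<in>H. var A) \<in> Pol U"
  by (intro Pol_prod var_in_carrier) auto

lemma D_relations_rel:
  "D_relations U I = {rel U H B (atom_defect I H B) | H B. H \<subseteq> U \<and> B \<in> U \<and> (\<forall>h \<in> H. h < B)}"
  by (simp add: D_relations_def rel_def upper_sum_def)

lemma rel_mem:
  assumes "H \<subseteq> U" "B \<in> U" "\<And>h. h \<in> H \<Longrightarrow> h < B" "atom_defect I H B \<le> m"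
  shows "rel U H B m \<in> D_ideal U I"
proof -
  let ?d = "atom_defect I H B"
  have "rel U H B ?d \<in> D_ideal U I"
    unfolding D_ideal_def D_relations_rel using assms by (intro idl_gen) blast
  then have "upper_sum U B ^ (m - ?d) * rel U H B ?d \<in> D_ideal U I"
    by (intro D_ideal_mult Pol_power upper_sum_Pol)
  moreover have "upper_sum U B ^ m = upper_sum U B ^ (m - ?d) * upper_sum U B ^ ?d"
    using assms(4) by (simp flip: power_add)
  ultimately show ?thesis by (simp add: rel_def mult_ac)
qed

lemma D_ideal_least:
  assumes "additive_set T"
    and "\<And>a H B. a \<in> Pol U \<Longrightarrow> H \<subseteq> U \<Longrightarrow> B \<in> U \<Longrightarrow> (\<And>h. h \<in> H \<Longrightarrow> h < B) \<Longrightarrow>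
      a * rel U H B (atom_defect I H B) \<in> T"
  shows "D_ideal U I \<subseteq> T"
  unfolding D_ideal_def D_relations_rel using assms by (intro idl_least) auto

lemma D_ideal_subsetI:
  assumes "\<And>H B. H \<subseteq> U \<Longrightarrow> B \<in> U \<Longrightarrow> (\<And>h. h \<in> H \<Longrightarrow> h < B) \<Longrightarrow>
      rel U H B (atom_defect I H B) \<in> D_ideal U I'"
  shows "D_ideal U I \<subseteq> D_ideal U I'"
  using assms by (intro D_ideal_least additive_D_ideal D_ideal_mult) auto

lemma atom_defect_antimono:
  fixes B :: "'a::{finite, complete_lattice}"
  assumes at: "atomic TYPE('a)" and H: "\<And>h. h \<in> H \<Longrightarrow> h < B" and "S \<subseteq> S'"
  shows "atom_defect S' H B \<le> atom_defect S H B"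
  using assms by (intro atom_defect_le_transfer) (auto intro: less_imp_le Sup_upper)

lemma D_ideal_mono:
  fixes U :: "'a::{finite, complete_lattice} set"
  assumes at: "atomic TYPE('a)" and "I \<subseteq> I'"
  shows "D_ideal U I \<subseteq> D_ideal U I'"
  using atom_defect_antimono[OF at] assms(2) by (intro D_ideal_subsetI rel_mem) auto

lemma atom_defect_insert_irrelevant:
  "\<not> M < B \<Longrightarrow> atom_defect (insert M S) H B = atom_defect S H B"
proof -
  assume "\<not> M < B"
  then have "{y \<in> insert M S. y < B} = {y \<in> S. y < B}" by auto
  then show ?thesis by (simp add: atom_defect_def)
qed

section \<open>The recursion for the ranks\<close>

text \<open>The weakening of the building property that the ring arguments use. The lower bound is
  taken in \<open>G\<close>, which for a building set excludes \<open>bot\<close>.\<close>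

definition join_closed :: "'a::{finite, complete_lattice} set \<Rightarrow> bool" where
  "join_closed G \<longleftrightarrow> (\<forall>x\<in>G. \<forall>y\<in>G. \<forall>z\<in>G. z \<le> x \<longrightarrow> z \<le> y \<longrightarrow> sup x y \<in> G)"

definition up_closed :: "'a::order set \<Rightarrow> 'a set \<Rightarrow> bool" where
  "up_closed G U \<longleftrightarrow> U \<subseteq> G \<and> (\<forall>u\<in>U. \<forall>g\<in>G. u \<le> g \<longrightarrow> g \<in> U)"

section \<open>Annihilation of the ideal of the center by a power of the upper sum\<close>

lemma power_congruence:
  assumes "v * (p - q) \<in> D_ideal U I" "p \<in> Pol U" "q \<in> Pol U"
  shows "v * p ^ n - v * q ^ n \<in> D_ideal U I"
proof (induction n)
  case (Suc n)
  have "p * (v * p ^ n - v * q ^ n) + q ^ n * (v * (p - q)) \<in> D_ideal U I"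
    by (rule additive_add[OF additive_D_ideal D_ideal_mult[OF assms(2) Suc]
        D_ideal_mult[OF Pol_power[OF assms(3)] assms(1)]])
  then show ?case by (simp add: algebra_simps)
qed (simp add: additive_zero[OF additive_D_ideal])

text \<open>Incomparable \<open>C\<close> and \<open>E\<close> with a common lower bound in \<open>G\<close> have their join in \<open>G\<close>, so
  the product of their variables is a relation.\<close>

lemma var_upper_sum_congruence:
  fixes U :: "'a::{finite, complete_lattice} set"
  assumes G: "join_closed G" and U: "up_closed G U"
    and M: "M \<in> G" "M \<le> B" "M \<le> C" and "B \<in> U" "C \<in> U" "\<not> B \<le> C"
  shows "var C * (upper_sum U B - upper_sum U (sup B C)) \<in> D_ideal U I"
proof -
  have "var C * var E \<in> D_ideal U I" if E: "E \<in> U" "B \<le> E" "\<not> C \<le> E" for E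
  proof -
    have "\<not> E \<le> C" using \<open>\<not> B \<le> C\<close> E(2) by (meson order_trans)
    have "sup C E \<in> G"
      using G U M E \<open>C \<in> U\<close> unfolding join_closed_def up_closed_def by (meson order_trans subsetD)
    then have "sup C E \<in> U" using U \<open>C \<in> U\<close> unfolding up_closed_def by (meson sup_ge1)
    \<comment> \<open>The empty set of atoms shows that the defect is 0, so the relation at
      \<open>sup C E\<close> is the bare product of the two variables.\<close>
    moreover have "atom_defect I {C, E} (sup C E) \<le> card ({} :: 'a set)"
    proof (rule atom_defect_le)
      have "Sup ({C, E} \<union> {y \<in> I. y < sup C E} \<union> {}) \<le> sup C E" by (intro Sup_least) auto
      moreover have "sup C E \<le> Sup ({C, E} \<union> {y \<in> I. y < sup C E} \<union> {})"
        by (intro sup_least Sup_upper) auto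
      ultimately show "sup C E = Sup ({C, E} \<union> {y \<in> I. y < sup C E} \<union> {})" by (rule antisym[rotated])
    qed simp
    moreover have "C < sup C E" "E < sup C E"
      using E(3) \<open>\<not> E \<le> C\<close> by (simp_all add: less_le_not_le)
    ultimately have "rel U {C, E} (sup C E) 0 \<in> D_ideal U I"
      using E \<open>C \<in> U\<close> by (intro rel_mem) auto
    moreover have "C \<noteq> E" using E(3) by blast
    ultimately show ?thesis by (simp add: rel_def)
  qed
  then have "(\<Sum>E\<in>{E \<in> U. B \<le> E \<and> \<not> C \<le> E}. var C * var E) \<in> D_ideal U I"
    by (intro additive_sum additive_D_ideal) auto
  moreover have "upper_sum U B - upper_sum U (sup B C) = (\<Sum>E\<in>{E \<in> U. B \<le> E \<and> \<not> C \<le> E}. var E)"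
    unfolding upper_sum_def
    by (subst sum_diff[symmetric]) (auto intro!: sum.cong)
  ultimately show ?thesis by (simp add: sum_distrib_left)
qed

text \<open>Because \<open>M \<le> C\<close>, the factor \<open>var C\<close> can replace
  \<open>M\<close> in \<open>I\<close>: the relation with \<open>insert C H\<close> at
  \<open>sup B C\<close> needs at most as many atoms. After multiplication by \<open>var C\<close>
  the upper sums at \<open>B\<close> and \<open>sup B C\<close> agree, which moves the relation back
  to \<open>B\<close>.\<close>

lemma var_mult_rel:
  fixes U :: "'a::{finite, complete_lattice} set"
  assumes at: "atomic TYPE('a)" and G: "join_closed G" and U: "up_closed G U"
    and M: "M \<in> G" "M < B" "M \<le> C" and BC: "B \<in> U" "C \<in> U" "\<not> B \<le> C"
    and H: "H \<subseteq> U" "\<And>h. h \<in> H \<Longrightarrow> h < B"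
  shows "var C * rel U H B (atom_defect (insert M I) H B) \<in> D_ideal U I"
proof -
  define m where "m = atom_defect (insert M I) H B"
  have "sup B C \<in> G"
    using G U M BC unfolding join_closed_def up_closed_def by (meson less_imp_le subsetD)
  then have B': "sup B C \<in> U" using U BC unfolding up_closed_def by (meson sup_ge1)
  have lt: "h < sup B C" if "h \<in> insert C H" for h
  proof (cases "h = C")
    case True
    then show ?thesis using BC(3) by (simp add: less_le_not_le)
  next
    case False
    then show ?thesis using that H(2)[of h] less_le_trans[of h B "sup B C"] by simp
  qed
  have "atom_defect I (insert C H) (sup B C) \<le> m"
    unfolding m_def
  proof (rule atom_defect_le_transfer[OF at])
    let ?X = "insert C H \<union> {y \<in> I. y < sup B C}"
    show "sup B C \<le> sup B (Sup ?X)" by (intro sup_least) (auto intro: le_supI2 Sup_upper)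
    have "C \<le> Sup ?X" by (intro Sup_upper) auto
    show "y \<le> Sup ?X" if "y \<in> H \<or> y \<in> insert M I \<and> y < B" for y
    proof (cases "y = M")
      case True
      then show ?thesis using order_trans[OF M(3) \<open>C \<le> Sup ?X\<close>] by simp
    next
      case False
      then have "y \<in> ?X" using that less_le_trans[of y B "sup B C"] by auto
      then show ?thesis by (rule Sup_upper)
    qed
  qed (use lt H(2) in \<open>auto intro: less_imp_le\<close>)
  then have *: "rel U (insert C H) (sup B C) m \<in> D_ideal U I"
    using H B' BC lt by (intro rel_mem) auto
  have "var C * (\<Prod>A\<in>H. var A) * upper_sum U (sup B C) ^ m \<in> D_ideal U I"
  \<comment> \<open>If \<open>C\<close> is already in \<open>H\<close>, the product over
    \<open>insert C H\<close> contains \<open>var C\<close> only once, and the second factor is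
    supplied by multiplication.\<close>
  proof (cases "C \<in> H")
    case True
    then have "var C * rel U H (sup B C) m \<in> D_ideal U I"
      using * BC by (simp add: insert_absorb D_ideal_mult var_in_carrier)
    then show ?thesis by (simp add: rel_def mult_ac)
  next
    case False
    then show ?thesis using * by (simp add: rel_def)
  qed
  moreover have "(\<Prod>A\<in>H. var A) * (var C * upper_sum U B ^ m - var C * upper_sum U (sup B C) ^ m) \<in> D_ideal U I"
    using H(1) var_upper_sum_congruence[OF G U M(1) less_imp_le[OF M(2)] M(3) BC]
    by (intro D_ideal_mult[OF prod_var_Pol] power_congruence upper_sum_Pol)
  ultimately have "var C * (\<Prod>A\<in>H. var A) * upper_sum U (sup B C) ^ m +
      (\<Prod>A\<in>H. var A) * (var C * upper_sum U B ^ m - var C * upper_sum U (sup B C) ^ m) \<in> D_ideal U I"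
    by (rule additive_add[OF additive_D_ideal])
  then show ?thesis by (simp add: m_def rel_def algebra_simps)
qed

text \<open>For a relation \<open>g\<close> of the center at \<open>B\<close> above
  \<open>M\<close>, every \<open>var C\<close> with \<open>M \<le> C\<close> and not
  \<open>B \<le> C\<close> kills \<open>g\<close>, so \<open>z\<close> acts on \<open>g\<close> as
  \<open>upper_sum U B\<close> does. Hence \<open>z ^ k * g\<close> is congruent to \<open>g\<close>
  with its exponent raised by \<open>k\<close>, enough by the triangle inequality to do without
  \<open>M\<close>.\<close>

lemma upper_sum_power_annihilates:
  fixes U :: "'a::{finite, complete_lattice} set"
  assumes at: "atomic TYPE('a)" and G: "join_closed G" and U: "up_closed G U"
    and M: "M \<in> G" "M \<notin> U" and j: "j \<in> D_ideal U (insert M I)"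
  shows "upper_sum U M ^ atom_defect I {} M * j \<in> D_ideal U I"
proof -
  define k z where "k = atom_defect I {} M" and "z = upper_sum U M"
  let ?T = "{j. z ^ k * j \<in> D_ideal U I}"
  have "D_ideal U (insert M I) \<subseteq> ?T"
  proof (rule D_ideal_least)
    show "additive_set ?T"
      using additive_D_ideal[of U I] by (simp add: additive_set_def right_diff_distrib)
    fix a H B assume a: "a \<in> Pol U" and H: "H \<subseteq> U" "\<And>h. h \<in> H \<Longrightarrow> h < B" and B: "B \<in> U"
    define g where "g = rel U H B (atom_defect (insert M I) H B)"
    have "z ^ k * g \<in> D_ideal U I"
    proof (cases "M < B")
      case False
      then have "g \<in> D_ideal U I"
        unfolding g_def using H B by (intro rel_mem) (auto simp: atom_defect_insert_irrelevant)
      then show ?thesis by (intro D_ideal_mult) (simp_all add: z_def upper_sum_Pol Pol_power)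
    next
      case True
      have "(\<Sum>C\<in>{C \<in> U. M \<le> C \<and> \<not> B \<le> C}. var C * g) \<in> D_ideal U I"
        unfolding g_def
        by (intro additive_sum additive_D_ideal var_mult_rel[OF at G U M(1) True _ B _ _ H]) auto
      moreover have "z - upper_sum U B = (\<Sum>C\<in>{C \<in> U. M \<le> C \<and> \<not> B \<le> C}. var C)"
        unfolding upper_sum_def z_def using True
        by (subst sum_diff[symmetric]) (auto intro!: sum.cong)
      ultimately have "g * (z - upper_sum U B) \<in> D_ideal U I"
        by (simp add: sum_distrib_left mult.commute)
      then have "g * z ^ k - g * upper_sum U B ^ k \<in> D_ideal U I"
        by (intro power_congruence) (auto simp: z_def upper_sum_Pol)
      moreover have "rel U H B (atom_defect (insert M I) H B + k) \<in> D_ideal U I"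
        using H B True atom_defect_triangle[OF at _ True, of H I] unfolding k_def
        by (intro rel_mem) (auto intro: less_imp_le)
      then have "g * upper_sum U B ^ k \<in> D_ideal U I"
        by (simp add: g_def rel_def power_add mult.assoc)
      ultimately have "(g * z ^ k - g * upper_sum U B ^ k) + g * upper_sum U B ^ k \<in> D_ideal U I"
        by (rule additive_add[OF additive_D_ideal])
      then show ?thesis by (simp add: mult.commute)
    qed
    then have "a * (z ^ k * g) \<in> D_ideal U I" by (rule D_ideal_mult[OF a])
    then show "a * rel U H B (atom_defect (insert M I) H B) \<in> ?T" by (simp add: g_def mult_ac)
  qed
  then show ?thesis using j by (auto simp: k_def z_def)
qed

section \<open>The ideal over \<open>insert M U\<close> as a blow-up ideal\<close>

lemma blowup_D_ideal:
  fixes U :: "'a::{finite, complete_lattice} set"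
  assumes at: "atomic TYPE('a)" and G: "join_closed G" and U: "up_closed G U"
    and M: "M \<in> G" "M \<notin> U" and k: "atom_defect I {} M > 0"
  shows "blowup (Pol U) (D_ideal U I) (D_ideal U (insert M I))
    ([:upper_sum U M, 1:] ^ atom_defect I {} M) (atom_defect I {} M)"
proof
  let ?k = "atom_defect I {} M" and ?p = "[:upper_sum U M, 1:]"
  have "subring_set (polys_over (Pol U))" by (intro subring_polys_over subring_int_poly)
  moreover have "?p \<in> polys_over (Pol U)"
    using additive_zero[OF additive_Pol]
    by (auto simp: polys_over_def coeff_pCons upper_sum_Pol Pol_1 split: nat.split)
  ultimately have "?p ^ n \<in> polys_over (Pol U)" for n
    unfolding subring_set_def by (induction n) auto
  then show "?p ^ ?k \<in> polys_over (Pol U)" .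
  show "coeff (?p ^ ?k) ?k = 1" by (rule coeff_linear_power)
  show "degree (?p ^ ?k) = ?k" by (rule degree_linear_power)
  have "coeff (?p ^ ?k) 0 = upper_sum U M ^ ?k"
    by (simp flip: poly_0_coeff_0 add: poly_power)
  then show "a * coeff (?p ^ ?k) 0 \<in> D_ideal U I" if "a \<in> D_ideal U (insert M I)" for a
    using upper_sum_power_annihilates[OF at G U M that] by (simp add: mult.commute)
qed (use k subring_int_poly ideal_D_ideal D_ideal_mono[OF at, of I "insert M I" U] in auto)

text \<open>The relations over \<open>insert M U\<close> are of three kinds. \<open>B = M\<close>
  forces \<open>H = {}\<close> by minimality and gives \<open>(x + z) ^ k\<close>;
  \<open>M \<in> H\<close> gives \<open>x\<close> times a relation of the center; the others are
  relations over \<open>U\<close>, since \<open>M\<close> occurs in no upper sum at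
  \<open>B \<in> U\<close>. Injectivity of evaluation turns this comparison of generators into an
  equivalence.\<close>

lemma D_ideal_blowup:
  fixes U :: "'a::{finite, complete_lattice} set" and I M
  defines "k \<equiv> atom_defect I {} M"
  defines "p \<equiv> [:upper_sum U M, 1:] ^ k"
  assumes at: "atomic TYPE('a)" and M: "M \<notin> U" "\<And>u. u \<in> U \<Longrightarrow> \<not> u < M"
    and b: "blowup (Pol U) (D_ideal U I) (D_ideal U (insert M I)) p k"
    and q: "q \<in> polys_over (Pol U)"
  shows "poly q (var M) \<in> D_ideal (insert M U) I \<longleftrightarrow>
    q \<in> blowup_ideal (Pol U) (D_ideal U I) (D_ideal U (insert M I)) p"
proof -
  interpret blowup "Pol U" "D_ideal U I" "D_ideal U (insert M I)" p k by (rule b)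
  let ?Ja = "D_ideal U I" and ?Jb = "D_ideal U (insert M I)" and ?J = "D_ideal (insert M U) I"
  let ?B = "blowup_ideal (Pol U) ?Ja ?Jb p"
  let ?ev = "\<lambda>q. poly q (var M)"
  have not_le: "\<not> M \<ge> B" if "B \<in> U" for B using that M by (metis order.not_eq_order_implies_strict)
  have sub: "Pol U \<subseteq> Pol (insert M U)" by (rule carrier_int_poly_mono) blast
  have upper_sum: "upper_sum (insert M U) B = upper_sum U B" if "B \<in> U" for B
    using not_le[OF that] unfolding upper_sum_def by (intro sum.cong) auto
  have upper_sum_M: "upper_sum (insert M U) M = upper_sum U M + var M"
  proof -
    have "{C \<in> insert M U. M \<le> C} = insert M {C \<in> U. M \<le> C}" by auto
    then show ?thesis using M(1) by (simp add: upper_sum_def add.commute)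
  qed
  have rel: "rel (insert M U) H B m = rel U H B m" if "B \<in> U" for H B m
    using upper_sum[OF that] by (simp add: rel_def)
  have rel_M: "rel (insert M U) {} M k = ?ev p"
    by (simp add: rel_def upper_sum_M p_def poly_power)
  \<comment> \<open>For \<open>M < B\<close> it makes no difference whether \<open>M\<close> enters
    the join through \<open>H\<close> or through \<open>I\<close>; this couples the variable
    \<open>var M\<close> to the center.\<close>
  have defect: "atom_defect I (insert M H) B = atom_defect (insert M I) H B" if "M < B" for H B
  proof -
    have "insert M H \<union> {y \<in> I. y < B} = H \<union> {y \<in> insert M I. y < B}" using that by auto
    then show ?thesis by (simp only: atom_defect_def)
  qed
  have J01: "?Ja \<subseteq> ?Jb" by (rule D_ideal_mono[OF at]) blast
  have Ja_sub: "?Ja \<subseteq> ?J"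
  proof (rule D_ideal_least[OF additive_D_ideal])
    fix a H B assume a: "a \<in> Pol U" and H: "H \<subseteq> U" "\<And>h. h \<in> H \<Longrightarrow> h < B" and B: "B \<in> U"
    have "rel (insert M U) H B (atom_defect I H B) \<in> ?J"
      using H B by (intro rel_mem) auto
    then have "rel U H B (atom_defect I H B) \<in> ?J" by (simp only: rel[OF B])
    then show "a * rel U H B (atom_defect I H B) \<in> ?J"
      using a sub by (intro D_ideal_mult) auto
  qed
  have Jb_var: "var M * j \<in> ?J" if "j \<in> ?Jb" for j
  proof -
    have "additive_set {j. var M * j \<in> ?J}"
      using additive_D_ideal[of "insert M U" I] by (simp add: additive_set_def right_diff_distrib)
    moreover have "var M * (a * rel U H B (atom_defect (insert M I) H B)) \<in> ?J"
      if a: "a \<in> Pol U" and H: "H \<subseteq> U" "\<And>h. h \<in> H \<Longrightarrow> h < B" and B: "B \<in> U" for a H B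
    proof (cases "M < B")
      case True
      have "rel (insert M U) (insert M H) B (atom_defect (insert M I) H B) \<in> ?J"
        using H B True by (intro rel_mem) (auto simp: defect)
      moreover have "M \<notin> H" using M(1) H(1) by blast
      ultimately have "var M * rel U H B (atom_defect (insert M I) H B) \<in> ?J"
        using rel[OF B] by (simp add: rel_def mult.assoc)
      then have "a * (var M * rel U H B (atom_defect (insert M I) H B)) \<in> ?J"
        by (rule D_ideal_mult[OF subsetD[OF sub a]])
      then show ?thesis by (simp add: mult.left_commute)
    next
      case False
      then have "rel (insert M U) H B (atom_defect (insert M I) H B) \<in> ?J"
        using H B by (intro rel_mem) (auto simp: atom_defect_insert_irrelevant)
      then show ?thesis
        using a sub rel[OF B] by (intro D_ideal_mult) (auto intro: var_in_carrier)
    qed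
    ultimately have "?Jb \<subseteq> {j. var M * j \<in> ?J}" by (intro D_ideal_least) auto
    then show ?thesis using that by blast
  qed
  have powM: "var M ^ n \<in> Pol (insert M U)" for n by (intro Pol_power var_in_carrier) simp
  have ev_Pol: "?ev q \<in> Pol (insert M U)" if "q \<in> polys_over (Pol U)" for q
    using that poly_var_image[of M U] by blast
  have B_J: "?ev q \<in> ?J" if qB: "q \<in> ?B" for q
  proof -
    obtain r s where q: "q = r + p * s" "r \<in> blowup_base ?Ja ?Jb" "s \<in> polys_over (Pol U)"
      using qB unfolding blowup_ideal_def by blast
    have "coeff r i * var M ^ i \<in> ?J" for i
    proof (cases i)
      case 0
      then show ?thesis using q(2) Ja_sub by (auto simp: blowup_base_def)
    next
      case (Suc l)
      then have "var M ^ l * (var M * coeff r i) \<in> ?J"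
        using q(2) powM by (intro D_ideal_mult Jb_var) (auto simp: blowup_base_def)
      then show ?thesis using Suc by (simp add: mult_ac)
    qed
    then have "?ev r \<in> ?J" by (simp add: poly_altdef additive_sum[OF additive_D_ideal])
    moreover have "rel (insert M U) {} M k \<in> ?J"
      by (intro rel_mem) (auto simp: k_def)
    then have "?ev s * ?ev p \<in> ?J" using ev_Pol[OF q(3)] unfolding rel_M by (intro D_ideal_mult)
    ultimately have "?ev r + ?ev s * ?ev p \<in> ?J" by (rule additive_add[OF additive_D_ideal])
    then show ?thesis by (simp add: q(1) mult.commute)
  qed
  have addB: "additive_set ?B" and multB: "\<And>a j. a \<in> polys_over (Pol U) \<Longrightarrow> j \<in> ?B \<Longrightarrow> a * j \<in> ?B"
    and subB: "?B \<subseteq> polys_over (Pol U)"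
    using ideal_J by (simp_all add: ideal_set_def)
  have base: "r \<in> ?B" if "r \<in> blowup_base ?Ja ?Jb" for r
    using that K_subset_J by blast
  have "?J \<subseteq> ?ev ` ?B"
  proof (rule D_ideal_least)
    show "additive_set (?ev ` ?B)"
      using addB by (auto simp: additive_set_def simp flip: poly_diff intro: image_eqI[of _ ?ev 0])
    fix a H B assume a: "a \<in> Pol (insert M U)" and H: "H \<subseteq> insert M U" "\<And>h. h \<in> H \<Longrightarrow> h < B"
      and B: "B \<in> insert M U"
    obtain q where q: "q \<in> polys_over (Pol U)" "a = ?ev q" using a poly_var_image[of M U] by blast
    obtain g where "g \<in> ?B" "rel (insert M U) H B (atom_defect I H B) = ?ev g"
    proof (cases "B = M")
      case True
      have "H = {}" using H True M(2) by fastforce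
      moreover have "p \<in> ?B"
      proof -
        have "0 + p * 1 \<in> ?B"
          unfolding blowup_ideal_def using subring_polys_over[OF subring_int_poly, of U]
            additive_zero[OF additive_D_ideal] by (fastforce simp: subring_set_def blowup_base_def)
        then show ?thesis by simp
      qed
      ultimately show thesis using that[of p] rel_M True by (simp add: k_def)
    next
      case False
      then have B: "B \<in> U" using B by blast
      show thesis
      proof (cases "M \<in> H")
        case False
        then have "rel U H B (atom_defect I H B) \<in> ?Ja" using H B by (intro rel_mem) auto
        then have "[:rel U H B (atom_defect I H B):] \<in> ?B"
          using additive_zero[OF additive_D_ideal]
          by (intro base) (auto simp: blowup_base_def coeff_pCons split: nat.split)
        then show thesis using that rel[OF B] by fastforce
      next
        case True
        define H' where "H' = H - {M}"
        have H': "H = insert M H'" "M \<notin> H'" "H' \<subseteq> U" "M < B" using True H by (auto simp: H'_def)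
        have "rel U H' B (atom_defect I H B) \<in> ?Jb"
          using H B H' defect by (intro rel_mem) auto
        then have "[:0, rel U H' B (atom_defect I H B):] \<in> ?B"
          using additive_zero[OF additive_D_ideal]
          by (intro base) (auto simp: blowup_base_def coeff_pCons split: nat.split)
        moreover have "rel (insert M U) H B (atom_defect I H B) = ?ev [:0, rel U H' B (atom_defect I H B):]"
          using H'(2) rel[OF B] by (simp add: H'(1) rel_def mult.assoc)
        ultimately show thesis using that by blast
      qed
    qed
    then have "a * rel (insert M U) H B (atom_defect I H B) = ?ev (q * g)" "q * g \<in> ?B"
      using q multB by simp_all
    then show "a * rel (insert M U) H B (atom_defect I H B) \<in> ?ev ` ?B" by blast
  qed
  moreover have "q = q'" if "?ev q = ?ev q'" "q' \<in> polys_over (Pol U)" for q'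
  proof -
    have "q - q' \<in> polys_over (Pol U)"
      using q that(2) additive_diff[OF additive_polys_over[OF additive_Pol]] by blast
    then show ?thesis using poly_var_eq_0[OF _ M(1), of "q - q'"] that(1) by simp
  qed
  ultimately show ?thesis using B_J subB by blast
qed

text \<open>For positive defect this is the blow-up formula carried over by evaluation. Defect 0
  means that \<open>M\<close> is already a join of elements of \<open>I\<close>: then
  \<open>1\<close> is a relation over \<open>insert M U\<close>, and \<open>M\<close> adds nothing
  to \<open>I\<close> in the defects over \<open>U\<close>, so both sides are 0.\<close>

theorem D_ideal_recursion:
  fixes U :: "'a::{finite, complete_lattice} set"
  assumes at: "atomic TYPE('a)" and G: "join_closed G" and U: "up_closed G U" "up_closed G (insert M U)"
    and M: "M \<notin> U"
    and fr: "free_rank (Pol U) (D_ideal U I) n0" "free_rank (Pol U) (D_ideal U (insert M I)) n1"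
  shows "\<exists>n. free_rank (Pol (insert M U)) (D_ideal (insert M U) I) n \<and>
    int n = int n0 + (int (atom_defect I {} M) - 1) * int n1"
proof -
  define k where "k = atom_defect I {} M"
  have MG: "M \<in> G" using U(2) by (auto simp: up_closed_def)
  have min: "\<not> u < M" if "u \<in> U" for u
    using U(1) MG M that unfolding up_closed_def by (meson less_imp_le)
  show ?thesis
  proof (cases "k = 0")
    case True
    have "rel (insert M U) {} M 0 \<in> D_ideal (insert M U) I"
      using True by (intro rel_mem) (auto simp: k_def)
    then have "p \<in> D_ideal (insert M U) I" if "p \<in> Pol (insert M U)" for p
      using D_ideal_mult[OF that] by (fastforce simp: rel_def)
    then have "D_ideal (insert M U) I = Pol (insert M U)" using D_ideal_subset by blast
    then have "free_rank (Pol (insert M U)) (D_ideal (insert M U) I) 0"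
      using free_rank_self[OF additive_Pol] by metis
    moreover have "D_ideal U (insert M I) = D_ideal U I"
    proof
      obtain A where "A \<subseteq> (atoms :: 'a set)" "card A = 0" "M = Sup ({} \<union> {y \<in> I. y < M} \<union> A)"
        using atom_defect_attained[OF at, of "{}" M I] True k_def by auto
      then have Sup: "M = Sup {y \<in> I. y < M}" by simp
      have "atom_defect I H B \<le> atom_defect (insert M I) H B" if H: "\<And>h. h \<in> H \<Longrightarrow> h < B" for H and B :: 'a
      proof (cases "M < B")
        case True
        let ?X = "H \<union> {y \<in> I. y < B}"
        have "Sup {y \<in> I. y < M} \<le> Sup ?X" using True by (intro Sup_subset_mono) auto
        then have "M \<le> Sup ?X" using Sup by simp
        then show ?thesis
          using H by (intro atom_defect_le_transfer[OF at]) (auto intro: less_imp_le Sup_upper)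
      qed (simp add: atom_defect_insert_irrelevant)
      then show "D_ideal U (insert M I) \<subseteq> D_ideal U I" by (intro D_ideal_subsetI rel_mem) auto
      show "D_ideal U I \<subseteq> D_ideal U (insert M I)" by (rule D_ideal_mono[OF at]) blast
    qed
    \<comment> \<open>Two bases of the same quotient have equal size, because both sizes compute the
      same \<open>chi_arr\<close>.\<close>
    then have "int n0 = int n1" using chi_arr_eq fr by metis
    ultimately show ?thesis using True by (intro exI[of _ 0]) (simp add: k_def)
  next
    case False
    let ?p = "[:upper_sum U M, 1:] ^ k"
    let ?Ja = "D_ideal U I" and ?Jb = "D_ideal U (insert M I)"
    have b: "blowup (Pol U) ?Ja ?Jb ?p k"
      using blowup_D_ideal[OF at G U(1) MG M, of I] False by (simp add: k_def)
    then have "free_rank (polys_over (Pol U)) (blowup_ideal (Pol U) ?Ja ?Jb ?p) (n0 + (k - 1) * n1)"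
      using fr by (rule blowup.free_rank_blowup)
    then have "free_rank (Pol (insert M U)) (D_ideal (insert M U) I) (n0 + (k - 1) * n1)"
    proof (rule free_rank_transport[where f = "\<lambda>q. poly q (var M)"])
      show "additive_set (polys_over (Pol U))" by (intro additive_polys_over additive_Pol)
      show "poly q (var M) \<in> D_ideal (insert M U) I \<longleftrightarrow> q \<in> blowup_ideal (Pol U) ?Ja ?Jb ?p"
        if "q \<in> polys_over (Pol U)" for q
        unfolding k_def using D_ideal_blowup[OF at M min _ that] b unfolding k_def by blast
      show "\<exists>q \<in> polys_over (Pol U). p - poly q (var M) \<in> D_ideal (insert M U) I"
        if p: "p \<in> Pol (insert M U)" for p
      proof -
        obtain q where "q \<in> polys_over (Pol U)" "p = poly q (var M)"
          using p poly_var_image[of M U] by blast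
        then show ?thesis using additive_zero[OF additive_D_ideal] by (intro bexI[of _ q]) auto
      qed
    qed (use poly_var_image[of M U] additive_D_ideal in auto)
    moreover have "int (n0 + (k - 1) * n1) = int n0 + (int k - 1) * int n1"
      using False by (simp add: of_nat_diff)
    ultimately show ?thesis unfolding k_def by blast
  qed
qed

section \<open>Base case and freeness of all rings\<close>

lemma Pol_empty:
  assumes "p \<in> Pol {}"
  shows "\<exists>c. p = of_int c"
proof
  have "Poly_Mapping.keys p \<subseteq> {0}" using assms by (auto simp: carrier_int_poly_ring)
  then have "Poly_Mapping.lookup p m = 0" if "m \<noteq> 0" for m
    using that by (meson in_keys_iff singletonD subsetD)
  then show "p = of_int (Poly_Mapping.lookup p 0)"
    by (intro poly_mapping_eqI) (auto simp: lookup_single when_def simp flip: single_of_int)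
qed

lemma free_rank_empty: "free_rank (Pol {}) (D_ideal {} I) 1"
proof -
  have "D_ideal {} I \<subseteq> {0}" by (rule D_ideal_least) (auto simp: additive_set_def)
  then have J: "D_ideal {} I = {0}" using additive_zero[OF additive_D_ideal] by blast
  show ?thesis
    unfolding free_rank_def J
  proof (rule exI[of _ "\<lambda>_. 1"], intro conjI ballI allI impI)
    fix p :: "'a int_poly" assume "p \<in> Pol {}"
    then obtain c where "p = of_int c" using Pol_empty by blast
    then show "\<exists>c. p - (\<Sum>i<1::nat. of_int (c i) * 1) \<in> {0}" by (intro exI[of _ "\<lambda>_. c"]) simp
  next
    fix c :: "nat \<Rightarrow> int" and i :: nat
    assume "(\<Sum>i<1. of_int (c i) * (1 :: 'a int_poly)) \<in> {0}" "i < 1"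
    then have "Poly_Mapping.single 0 (c 0) = (0 :: 'a int_poly)" "i = 0" by (simp_all flip: single_of_int)
    then show "c i = 0" by (metis lookup_single_eq lookup_zero)
  qed (rule Pol_1)
qed

lemma up_closed_Diff_minimal:
  assumes "up_closed G U" "\<And>u. u \<in> U \<Longrightarrow> u \<le> M \<Longrightarrow> u = M"
  shows "up_closed G (U - {M})"
  using assms unfolding up_closed_def by blast

text \<open>A minimal element is removed at each step. \<open>I\<close> stays arbitrary in the
  induction because the recursion needs the smaller set with both \<open>I\<close> and
  \<open>insert M I\<close>.\<close>

lemma free_rank_exists:
  fixes U :: "'a::{finite, complete_lattice} set"
  assumes at: "atomic TYPE('a)" and G: "join_closed G" and U: "up_closed G U"
  shows "\<exists>n. free_rank (Pol U) (D_ideal U I) n"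
  using U
proof (induction "card U" arbitrary: U I)
  case 0
  then have "U = {}" by simp
  then show ?case using free_rank_empty by blast
next
  case (Suc n)
  then have "U \<noteq> {}" by auto
  then obtain M where M: "M \<in> U" "\<And>u. u \<in> U \<Longrightarrow> u \<le> M \<Longrightarrow> u = M"
    using finite_has_minimal[of U] by (metis finite)
  define U' where "U' = U - {M}"
  have U: "U = insert M U'" "M \<notin> U'" using M(1) by (auto simp: U'_def)
  have "card U' = n" using Suc.hyps(2) M(1) by (simp add: U'_def)
  moreover have U': "up_closed G U'" unfolding U'_def using Suc.prems M(2) by (rule up_closed_Diff_minimal)
  ultimately obtain n0 n1 where "free_rank (Pol U') (D_ideal U' I) n0"
      "free_rank (Pol U') (D_ideal U' (insert M I)) n1"
    using Suc.hyps(1) by metis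
  then show ?case
    using D_ideal_recursion[OF at G U' _ U(2)] Suc.prems unfolding U(1) by blast
qed

lemma chi_arr_insert:
  fixes U :: "'a::{finite, complete_lattice} set"
  assumes at: "atomic TYPE('a)" and G: "join_closed G" and U: "up_closed G U" "up_closed G (insert M U)"
    and M: "M \<notin> U"
  shows "chi_arr (insert M U) I = chi_arr U I + (int (atom_defect I {} M) - 1) * chi_arr U (insert M I)"
proof -
  obtain n0 n1 where n: "free_rank (Pol U) (D_ideal U I) n0" "free_rank (Pol U) (D_ideal U (insert M I)) n1"
    using free_rank_exists[OF at G U(1)] by blast
  then show ?thesis using D_ideal_recursion[OF at G U M n] n chi_arr_eq by metis
qed

lemma chi_arr_cong: "D_ideal U I = D_ideal U I' \<Longrightarrow> chi_arr U I = chi_arr U I'"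
  unfolding chi_arr_def D_ring_def genideal_eq_idl[OF D_relations_subset_carrier] D_ideal_def by simp

text \<open>A violating antichain \<open>T\<close> lies strictly below its join, which therefore
  needs no atoms: with \<open>H = {}\<close> and exponent 0 the relation at \<open>Sup T\<close> is
  \<open>1\<close>, and the ring is zero.\<close>

lemma chi_arr_not_nested:
  fixes G :: "'a::{finite, complete_lattice} set"
  assumes "S \<subseteq> G" "S \<notin> nested_sets G"
  shows "chi_arr G S = 0"
proof -
  have "\<exists>T \<subseteq> S. card T \<ge> 2 \<and>
      (\<forall>x \<in> T. \<forall>y \<in> T. x \<noteq> y \<longrightarrow> \<not> x \<le> y \<and> \<not> y \<le> x) \<and> Sup T \<in> G"
    using assms unfolding nested_sets_def mem_Collect_eq by meson
  then obtain T where T: "T \<subseteq> S" "card T \<ge> 2" "Sup T \<in> G"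
      "\<And>x y. x \<in> T \<Longrightarrow> y \<in> T \<Longrightarrow> x \<noteq> y \<Longrightarrow> \<not> x \<le> y \<and> \<not> y \<le> x"
    by metis
  have lt: "t < Sup T" if t: "t \<in> T" for t
  proof -
    have "\<not> T \<subseteq> {t}" using T(2) card_mono[of "{t}" T] by auto
    then obtain t' where "t' \<in> T" "t' \<noteq> t" by blast
    then have "\<not> t' \<le> t" using T(4) t by blast
    then have "t \<noteq> Sup T" using Sup_upper[OF \<open>t' \<in> T\<close>] by metis
    then show ?thesis using Sup_upper[OF t] by simp
  qed
  have "atom_defect S {} (Sup T) \<le> card ({} :: 'a set)"
  proof (rule atom_defect_le)
    show "Sup T = Sup ({} \<union> {y \<in> S. y < Sup T} \<union> {})"
      using T(1) lt by (intro antisym Sup_subset_mono Sup_least) (auto intro: less_imp_le)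
  qed simp
  then have "rel G {} (Sup T) 0 \<in> D_ideal G S" using T(3) by (intro rel_mem) auto
  then have "p \<in> D_ideal G S" if "p \<in> Pol G" for p
    using D_ideal_mult[OF that] by (fastforce simp: rel_def)
  then have "D_ideal G S = Pol G" using D_ideal_subset by blast
  then have "free_rank (Pol G) (D_ideal G S) 0"
    using free_rank_self[OF additive_Pol] by metis
  then show ?thesis by (simp add: chi_arr_eq)
qed

section \<open>Unrolling the recursion over a set of removed elements\<close>

lemma sum_Pow_insert:
  assumes "finite V" "M \<notin> V"
  shows "sum f (Pow (insert M V)) = (\<Sum>H\<in>Pow V. f H + f (insert M H))"
proof -
  have "sum f (Pow (insert M V)) = sum f (Pow V) + sum f (insert M ` Pow V)"
    unfolding Pow_insert using assms by (intro sum.union_disjoint) auto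
  also have "sum f (insert M ` Pow V) = (\<Sum>H\<in>Pow V. f (insert M H))"
    using assms(2) by (intro sum.reindex_cong[OF _ refl]) (auto simp: inj_on_def)
  finally show ?thesis by (simp add: sum.distrib)
qed

lemma atom_defect_cong:
  fixes B :: "'a::{finite, complete_lattice}"
  assumes "\<And>y. y < B \<Longrightarrow> y \<in> S \<longleftrightarrow> y \<in> S'"
  shows "atom_defect S H B = atom_defect S' H B"
proof -
  have "{y \<in> S. y < B} = {y \<in> S'. y < B}" using assms by blast
  then show ?thesis by (simp add: atom_defect_def)
qed

text \<open>The defect at \<open>A\<close> is taken with all of \<open>H\<close> present. It sees
  only elements below \<open>A\<close>, which the recursion removes before \<open>A\<close>, so the
  product records no order of removal.\<close>

definition weight :: "'a::{finite, complete_lattice} set \<Rightarrow> 'a set \<Rightarrow> int" where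
  "weight I H = (\<Prod>A\<in>H. int (atom_defect (I \<union> H) {} A) - 1)"

lemma chi_arr_unroll:
  fixes U V :: "'a::{finite, complete_lattice} set"
  assumes at: "atomic TYPE('a)" and G: "join_closed G"
    and U: "up_closed G U" and UV: "up_closed G (U \<union> V)" "U \<inter> V = {}"
  shows "chi_arr (U \<union> V) I = (\<Sum>H\<in>Pow V. weight I H * chi_arr U (I \<union> H))"
  using UV
proof (induction "card V" arbitrary: V I)
  case 0
  then have "V = {}" by simp
  then show ?case by (simp add: weight_def)
next
  case (Suc n)
  then have "V \<noteq> {}" by auto
  then obtain M where M: "M \<in> V" "\<And>u. u \<in> V \<Longrightarrow> u \<le> M \<Longrightarrow> u = M"
    using finite_has_minimal[of V] by (metis finite)
  define V' where "V' = V - {M}"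
  have V: "V = insert M V'" "M \<notin> V'" using M(1) by (auto simp: V'_def)
  have card: "n = card V'" using Suc.hyps(2) M(1) by (simp add: V'_def)
  have MU: "M \<notin> U" using M(1) Suc.prems(2) by blast
  \<comment> \<open>\<open>M\<close> is minimal in all of \<open>U \<union> V\<close>: an element of
    the up-closed set \<open>U\<close> below \<open>M\<close> would put \<open>M\<close> into
    \<open>U\<close>.\<close>
  have "u = M" if "u \<in> U \<union> V" "u \<le> M" for u
    using that M U Suc.prems MU unfolding up_closed_def by blast
  then have "up_closed G (U \<union> V - {M})" by (rule up_closed_Diff_minimal[OF Suc.prems(1)])
  moreover have "U \<union> V - {M} = U \<union> V'" using MU by (auto simp: V'_def)
  ultimately have up: "up_closed G (U \<union> V')" by simp
  have dis: "U \<inter> V' = {}" using Suc.prems(2) by (auto simp: V'_def)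
  have eq: "U \<union> V = insert M (U \<union> V')" by (simp add: V(1))
  have step: "weight I (insert M H) = (int (atom_defect I {} M) - 1) * weight (insert M I) H"
    if H: "H \<in> Pow V'" for H
  proof -
    \<comment> \<open>No member of \<open>H\<close> lies below the minimal element \<open>M\<close>,
      so the factor of \<open>M\<close> sees only \<open>I\<close>.\<close>
    have "atom_defect (I \<union> insert M H) {} M = atom_defect I {} M"
      using H M(2) by (intro atom_defect_cong) (auto simp: V'_def)
    moreover have "M \<notin> H" using H V(2) by blast
    ultimately show ?thesis by (simp add: weight_def)
  qed
  have "chi_arr (U \<union> V) I = chi_arr (U \<union> V') I +
      (int (atom_defect I {} M) - 1) * chi_arr (U \<union> V') (insert M I)"
    unfolding eq using up Suc.prems(1) MU V(2) eq by (intro chi_arr_insert[OF at G]) auto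
  also have "\<dots> = (\<Sum>H\<in>Pow V'. weight I H * chi_arr U (I \<union> H)) +
      (\<Sum>H\<in>Pow V'. weight I (insert M H) * chi_arr U (I \<union> insert M H))"
    unfolding Suc.hyps(1)[OF card up dis] by (simp add: sum_distrib_left step mult.assoc)
  also have "\<dots> = (\<Sum>H\<in>Pow V. weight I H * chi_arr U (I \<union> H))"
    unfolding V(1) using V(2) by (simp add: sum_Pow_insert sum.distrib)
  finally show ?case .
qed

text \<open>An element \<open>E\<close> of \<open>U\<close> with a lower bound in \<open>X\<close> has its join with \<open>b\<close> in \<open>U\<close>. Hence
  \<open>var E\<close> vanishes unless \<open>b \<le> E\<close>, and \<open>upper_sum U B\<close> equals \<open>upper_sum U (sup B b)\<close>.\<close>

lemma D_ideal_same_join: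
  fixes G :: "'a::{finite, complete_lattice} set"
  assumes at: "atomic TYPE('a)" and G: "join_closed G" and b: "b \<in> G"
    and X: "X \<subseteq> G" "Sup X = b"
  defines "U \<equiv> {g \<in> G. \<not> g \<le> b}"
  shows "D_ideal U (I \<union> X) = D_ideal U (insert b I)"
proof
  have Xb: "x \<le> b" if "x \<in> X" for x using that X(2) by (auto intro: Sup_upper)
  show "D_ideal U (insert b I) \<subseteq> D_ideal U (I \<union> X)"
  proof (intro D_ideal_subsetI rel_mem)
    fix H and B :: 'a assume H: "\<And>h. h \<in> H \<Longrightarrow> h < B"
    let ?Y = "H \<union> {y \<in> I \<union> X. y < B}"
    have "b \<le> Sup ?Y" if "b < B"
      unfolding X(2)[symmetric] using that Xb by (intro Sup_subset_mono) (auto intro: le_less_trans)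
    then show "atom_defect (I \<union> X) H B \<le> atom_defect (insert b I) H B"
      using H by (intro atom_defect_le_transfer[OF at]) (auto intro: less_imp_le Sup_upper)
  qed
  show "D_ideal U (I \<union> X) \<subseteq> D_ideal U (insert b I)"
  proof (rule D_ideal_subsetI)
    fix H B assume H: "H \<subseteq> U" "\<And>h. h \<in> H \<Longrightarrow> h < B" and B: "B \<in> U"
    let ?d = "atom_defect (I \<union> X) H B"
    show "rel U H B ?d \<in> D_ideal U (insert b I)"
    \<comment> \<open>Unless \<open>B\<close> lies above some \<open>x\<close> in \<open>X\<close>
      without lying above \<open>b\<close>, the two defects at \<open>B\<close> compare
      directly.\<close>
    proof (cases "\<not> b < B \<and> (\<exists>x\<in>X. x < B)")
      case False
      have "atom_defect (insert b I) H B \<le> ?d"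
      proof (rule atom_defect_le_transfer[OF at])
        fix y assume y: "y \<in> H \<or> y \<in> I \<union> X \<and> y < B"
        let ?Y = "H \<union> {y \<in> insert b I. y < B}"
        show "y \<le> Sup ?Y"
        proof (cases "y \<in> H \<or> y \<in> I \<and> y < B")
          case True
          then show ?thesis by (intro Sup_upper) auto
        next
          case 2: False
          then have "y \<in> X" "y < B" using y by auto
          then have "b < B" using False by blast
          then have "b \<le> Sup ?Y" by (intro Sup_upper) auto
          then show ?thesis using Xb[OF \<open>y \<in> X\<close>] by (rule order_trans[rotated])
        qed
      qed (use H in \<open>auto intro: less_imp_le\<close>)
      then show ?thesis using H B by (intro rel_mem) auto
    next
      case True
      then obtain x where x: "x \<in> X" "x < B" "\<not> b < B" by blast
      have xG: "x \<in> G" "x \<le> b" using x X Xb by auto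
      have join: "sup E b \<in> U" if "E \<in> U" "x \<le> E" for E
      proof -
        have "sup E b \<in> G" using G that xG b unfolding join_closed_def U_def by blast
        moreover have "\<not> sup E b \<le> b" using that by (simp add: U_def)
        ultimately show ?thesis by (simp add: U_def)
      qed
      have lt_sup: "b < sup E b" if "E \<in> U" for E
        using that by (simp add: U_def less_le_not_le)
      have var: "var E \<in> D_ideal U (insert b I)" if E: "E \<in> U" "B \<le> E" "\<not> b \<le> E" for E
      proof -
        have "x \<le> E" using x E by (meson less_imp_le order_trans)
        have "atom_defect (insert b I) {E} (sup E b) \<le> card ({} :: 'a set)"
        proof (rule atom_defect_le)
          let ?Y = "{E} \<union> {y \<in> insert b I. y < sup E b} \<union> {}"
          have "sup E b \<le> Sup ?Y" using lt_sup[OF E(1)] by (intro sup_least Sup_upper) auto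
          moreover have "Sup ?Y \<le> sup E b" by (intro Sup_least) (auto intro: less_imp_le)
          ultimately show "sup E b = Sup ?Y" by (rule antisym)
        qed simp
        moreover have "E < sup E b" using E(3) by (simp add: less_le_not_le)
        ultimately have "rel U {E} (sup E b) 0 \<in> D_ideal U (insert b I)"
          using E join[OF E(1) \<open>x \<le> E\<close>] by (intro rel_mem) auto
        then show ?thesis by (simp add: rel_def)
      qed
      \<comment> \<open>\<open>sup B b\<close> lies strictly above \<open>b\<close>, so that there
        \<open>b\<close> can take over from \<open>X\<close> in the defect; the upper sums at
        \<open>B\<close> and \<open>sup B b\<close> differ only by vanishing variables.\<close>
      define B' where "B' = sup B b"
      have B': "B' \<in> U" unfolding B'_def using join[OF B] x(2) by simp
      have "upper_sum U B - upper_sum U B' = (\<Sum>E\<in>{E \<in> U. B \<le> E \<and> \<not> b \<le> E}. var E)"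
        unfolding upper_sum_def B'_def
        by (subst sum_diff[symmetric]) (auto intro!: sum.cong)
      also have "\<dots> \<in> D_ideal U (insert b I)"
        using var by (intro additive_sum additive_D_ideal) auto
      finally have diff: "upper_sum U B - upper_sum U B' \<in> D_ideal U (insert b I)" .
      have lt: "h < B'" if "h \<in> H" for h
        unfolding B'_def using H(2)[OF that] by (rule less_le_trans) simp
      have "atom_defect (insert b I) H B' \<le> ?d"
      proof (rule atom_defect_le_transfer[OF at])
        let ?Y = "H \<union> {y \<in> insert b I. y < B'}"
        have bY: "b \<le> Sup ?Y" using lt_sup[OF B] by (intro Sup_upper) (auto simp: B'_def)
        then show "B' \<le> sup B (Sup ?Y)" unfolding B'_def by (intro sup_least) (auto intro: le_supI2)
        fix y assume y: "y \<in> H \<or> y \<in> I \<union> X \<and> y < B"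
        show "y \<le> Sup ?Y"
        proof (cases "y \<in> X")
          case True
          then show ?thesis using Xb bY by (meson order_trans)
        next
          case False
          then have "y \<in> ?Y" using y less_le_trans[of y B B'] by (auto simp: B'_def)
          then show ?thesis by (rule Sup_upper)
        qed
      qed (use H(2) lt in \<open>auto intro: less_imp_le simp: B'_def\<close>)
      then have rel': "rel U H B' ?d \<in> D_ideal U (insert b I)"
        using H(1) B' lt by (intro rel_mem)
      let ?P = "\<Prod>A\<in>H. var A"
      have "?P * (upper_sum U B - upper_sum U B') \<in> D_ideal U (insert b I)"
        using diff H(1) by (intro D_ideal_mult prod_var_Pol)
      then have "?P * upper_sum U B ^ ?d - ?P * upper_sum U B' ^ ?d \<in> D_ideal U (insert b I)"
        by (intro power_congruence upper_sum_Pol)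
      then have "(?P * upper_sum U B ^ ?d - ?P * upper_sum U B' ^ ?d) + rel U H B' ?d \<in> D_ideal U (insert b I)"
        using rel' by (rule additive_add[OF additive_D_ideal])
      then show ?thesis by (simp add: rel_def)
    qed
  qed
qed

section \<open>Building sets\<close>

lemma below_factor:
  assumes "x \<in> G" "x \<le> p"
  shows "\<exists>f \<in> factors G p. x \<le> f"
proof -
  have "finite {g \<in> G. g \<le> p}" by simp
  then obtain f where "f \<in> {g \<in> G. g \<le> p}" "x \<le> f" "\<forall>g \<in> {g \<in> G. g \<le> p}. f \<le> g \<longrightarrow> f = g"
    using finite_has_maximal2[of "{g \<in> G. g \<le> p}" x] assms by auto
  then show ?thesis unfolding factors_def maximal_elements_def by (auto simp: less_le)
qed

lemma factorsD: "f \<in> factors G p \<Longrightarrow> f \<in> G \<and> f \<le> p"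
  by (simp add: factors_def maximal_elements_def)

lemma factors_maximal: "f \<in> factors G p \<Longrightarrow> g \<in> G \<Longrightarrow> g \<le> p \<Longrightarrow> \<not> f < g"
  by (simp add: factors_def maximal_elements_def)

locale building_factors =
  fixes G :: "'a::{finite, complete_lattice} set" and p :: 'a
  assumes G: "building_set G" and p: "p \<noteq> bot"
begin

abbreviation "F \<equiv> factors G p"

lemma factorization:
  obtains \<phi> :: "'a \<Rightarrow> 'a \<Rightarrow> 'a"
  where "bij_betw \<phi> {bot..p} (\<Pi>\<^sub>E g \<in> F. {bot..g})"
    and "\<And>x y. x \<le> p \<Longrightarrow> y \<le> p \<Longrightarrow> x \<le> y \<longleftrightarrow> (\<forall>g \<in> F. \<phi> x g \<le> \<phi> y g)"
    and "\<And>g h. g \<in> F \<Longrightarrow> h \<in> F \<Longrightarrow> \<phi> g h = (if h = g then g else bot)"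
proof -
  from G p obtain \<phi> :: "'a \<Rightarrow> 'a \<Rightarrow> 'a" where "bij_betw \<phi> {bot..p} (\<Pi>\<^sub>E g \<in> F. {bot..g}) \<and>
      (\<forall>x \<in> {bot..p}. \<forall>y \<in> {bot..p}. x \<le> y \<longleftrightarrow> (\<forall>g \<in> F. \<phi> x g \<le> \<phi> y g)) \<and>
      (\<forall>g \<in> F. \<forall>h \<in> F. \<phi> g h = (if h = g then g else bot))"
    unfolding building_set_def by blast
  then show thesis by (intro that[of \<phi>]) auto
qed

lemma Sup_factors: "Sup F = p"
proof (rule antisym)
  obtain \<phi> :: "'a \<Rightarrow> 'a \<Rightarrow> 'a" where \<phi>: "bij_betw \<phi> {bot..p} (\<Pi>\<^sub>E g \<in> F. {bot..g})"
     "\<And>x y. x \<le> p \<Longrightarrow> y \<le> p \<Longrightarrow> x \<le> y \<longleftrightarrow> (\<forall>g \<in> F. \<phi> x g \<le> \<phi> y g)"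
     "\<And>g h. g \<in> F \<Longrightarrow> h \<in> F \<Longrightarrow> \<phi> g h = (if h = g then g else bot)"
    by (rule factorization) blast
  show le: "Sup F \<le> p" by (intro Sup_least) (simp add: factorsD)
  have "\<phi> p g \<le> \<phi> (Sup F) g" if g: "g \<in> F" for g
  proof -
    have "\<phi> p \<in> (\<Pi>\<^sub>E g \<in> F. {bot..g})" using bij_betwE[OF \<phi>(1)] by auto
    then have "\<phi> p g \<le> g" using g by auto
    also have "g = \<phi> g g" using \<phi>(3) g by simp
    also have "\<phi> g g \<le> \<phi> (Sup F) g" using \<phi>(2)[of g "Sup F"] g le factorsD[OF g] Sup_upper[OF g] by blast
    finally show ?thesis .
  qed
  then show "p \<le> Sup F" using \<phi>(2) le by blast
qed

text \<open>The coordinates of \<open>z\<close> are bounded by those of \<open>f\<close> and of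
  \<open>f'\<close>, and at every factor one of these two is \<open>bot\<close>.\<close>

lemma factors_disjoint:
  assumes f: "f \<in> F" "f' \<in> F" "f \<noteq> f'" and z: "z \<le> f" "z \<le> f'"
  shows "z = bot"
proof -
  obtain \<phi> :: "'a \<Rightarrow> 'a \<Rightarrow> 'a" where \<phi>0: "bij_betw \<phi> {bot..p} (\<Pi>\<^sub>E g \<in> F. {bot..g})"
    and \<phi>: "\<And>x y. x \<le> p \<Longrightarrow> y \<le> p \<Longrightarrow> x \<le> y \<longleftrightarrow> (\<forall>g \<in> F. \<phi> x g \<le> \<phi> y g)"
     "\<And>g h. g \<in> F \<Longrightarrow> h \<in> F \<Longrightarrow> \<phi> g h = (if h = g then g else bot)"
    by (rule factorization) blast
  have "z \<le> p" using z factorsD[OF f(1)] by (meson order_trans)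
  have "\<phi> z g \<le> \<phi> bot g" if g: "g \<in> F" for g
  proof -
    have "\<phi> z g \<le> \<phi> f g" "\<phi> z g \<le> \<phi> f' g"
      using \<phi>(1)[of z f] \<phi>(1)[of z f'] \<open>z \<le> p\<close> f z g factorsD by blast+
    then have "\<phi> z g \<le> bot" using \<phi>(2)[OF f(1) g] \<phi>(2)[OF f(2) g] f(3) by (auto split: if_splits)
    then show ?thesis by (meson bot_least order_trans)
  qed
  then have "z \<le> bot" using \<phi>(1)[of z bot] \<open>z \<le> p\<close> by simp
  then show ?thesis by (simp add: bot_unique)
qed

text \<open>Other factors cannot help to generate \<open>f\<close>. The element \<open>v\<close>
  with the coordinate of \<open>u\<close> at \<open>f\<close> and full coordinates elsewhere bounds
  \<open>u\<close> and the other factors, so \<open>p \<le> v\<close>, and the coordinate of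
  \<open>u\<close> at \<open>f\<close> is full as well.\<close>

lemma factor_complement:
  assumes f: "f \<in> F" and u: "u \<le> f" and le: "p \<le> sup u (Sup (F - {f}))"
  shows "u = f"
proof -
  obtain \<phi> :: "'a \<Rightarrow> 'a \<Rightarrow> 'a" where \<phi>: "bij_betw \<phi> {bot..p} (\<Pi>\<^sub>E g \<in> F. {bot..g})"
     "\<And>x y. x \<le> p \<Longrightarrow> y \<le> p \<Longrightarrow> x \<le> y \<longleftrightarrow> (\<forall>g \<in> F. \<phi> x g \<le> \<phi> y g)"
     "\<And>g h. g \<in> F \<Longrightarrow> h \<in> F \<Longrightarrow> \<phi> g h = (if h = g then g else bot)"
    by (rule factorization) blast
  have fp: "f \<le> p" using factorsD[OF f] by simp
  then have up: "u \<le> p" using u by (rule order_trans[rotated])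
  have \<phi>u: "\<phi> u \<in> (\<Pi>\<^sub>E g \<in> F. {bot..g})" using bij_betwE[OF \<phi>(1)] up by auto
  have u_le: "\<phi> u g \<le> \<phi> f g" if "g \<in> F" for g using \<phi>(2)[OF up fp] u that by blast
  define w where "w = (\<lambda>g\<in>F. if g = f then \<phi> u f else g)"
  have "w \<in> (\<Pi>\<^sub>E g \<in> F. {bot..g})" using \<phi>u f by (auto simp: w_def)
  then obtain v where v: "v \<le> p" "\<phi> v = w" using \<phi>(1) unfolding bij_betw_def by (metis atLeastAtMost_iff imageE)
  have "\<phi> u g \<le> \<phi> v g" if "g \<in> F" for g
    using u_le[OF that] \<phi>(3)[OF f that] f that by (cases "g = f") (auto simp: v(2) w_def bot_unique)
  then have "u \<le> v" using \<phi>(2)[OF up v(1)] by blast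
  moreover have "g \<le> v" if "g \<in> F - {f}" for g
  proof -
    have "\<phi> g h \<le> \<phi> v h" if "h \<in> F" for h
      using \<open>g \<in> F - {f}\<close> \<phi>(3)[of g h] that by (auto simp: v(2) w_def)
    then show ?thesis using \<phi>(2)[of g v] v(1) factorsD[of g G p] that by blast
  qed
  then have "Sup (F - {f}) \<le> v" by (rule Sup_least)
  ultimately have "p \<le> v" using le by (meson order_trans sup_least)
  then have "\<phi> f f \<le> \<phi> v f" using \<phi>(2)[OF fp v(1)] fp f by (meson order_trans)
  then have *: "f \<le> \<phi> u f" using \<phi>(3)[OF f f] f by (simp add: v(2) w_def)
  have "\<phi> f g \<le> \<phi> u g" if "g \<in> F" for g
    using * \<phi>(3)[OF f that] by (cases "g = f") auto
  then have "f \<le> u" using \<phi>(2)[OF fp up] by blast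
  with u show ?thesis by (rule antisym)
qed

end

text \<open>A common lower bound other than \<open>bot\<close> forces \<open>x\<close> and
  \<open>y\<close> under the same factor of \<open>sup x y\<close>, since distinct factors meet only
  in \<open>bot\<close>; that factor is then the join.\<close>

lemma building_join_closed:
  fixes G :: "'a::{finite, complete_lattice} set"
  assumes G: "building_set G"
  shows "join_closed G"
  unfolding join_closed_def
proof (intro ballI impI)
  fix x y z assume xyz: "x \<in> G" "y \<in> G" "z \<in> G" "z \<le> x" "z \<le> y"
  have z: "z \<noteq> bot" using G xyz unfolding building_set_def by auto
  then have "sup x y \<noteq> bot" using xyz(4) by (metis bot_unique le_supI1)
  then interpret building_factors G "sup x y" using G by unfold_locales
  obtain f where f: "f \<in> F" "x \<le> f" using below_factor[OF xyz(1), of "sup x y"] by auto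
  obtain f' where f': "f' \<in> F" "y \<le> f'" using below_factor[OF xyz(2), of "sup x y"] by auto
  have "f = f'" using factors_disjoint[OF f(1) f'(1), of z] z xyz f f' by (meson order_trans)
  then have "sup x y = f" using f f' factorsD[of f G "sup x y"] by (intro antisym sup_least) auto
  then show "sup x y \<in> G" using factorsD[OF f(1)] by simp
qed

lemma building_atoms:
  fixes G :: "'a::{finite, complete_lattice} set"
  assumes G: "building_set G"
  shows "atoms \<subseteq> G"
proof
  fix a :: 'a assume a: "a \<in> atoms"
  then have a0: "bot < a" "\<And>z. bot < z \<Longrightarrow> \<not> z < a" by (auto simp: atoms_def covers_def)
  then interpret building_factors G a using G by unfold_locales auto
  have "F \<noteq> {}" using Sup_factors a0(1) by force
  then obtain f where f: "f \<in> F" by blast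
  have "f \<in> G" "f \<le> a" using factorsD[OF f] by auto
  then have "f \<noteq> bot" using G unfolding building_set_def by auto
  then have "f = a" using a0(2)[of f] \<open>f \<le> a\<close> by (simp add: less_le bot_unique)
  then show "a \<in> G" using \<open>f \<in> G\<close> by simp
qed

context building_factors
begin

text \<open>Optimal atom sets for the factors unite to one for \<open>p\<close>. Conversely, every
  generator of \<open>p\<close> lies in \<open>G\<close> and thus below a factor; no atom lies below
  two of them, and by \<open>factor_complement\<close> the atoms below \<open>f\<close> together
  with \<open>X\<close> generate \<open>f\<close>. Factors in \<open>X\<close> drop out because
  \<open>p \<notin> G\<close> puts them strictly below \<open>p\<close>.\<close>

lemma atom_defect_factors:
  assumes at: "atomic TYPE('a)" and pG: "p \<notin> G" and X: "\<And>x. x \<in> X \<Longrightarrow> x < p \<Longrightarrow> x \<in> G"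
  shows "atom_defect X {} p = (\<Sum>f\<in>F - X. atom_defect X {} f)"
proof (rule antisym)
  have fp: "f < p" if "f \<in> F" for f using factorsD[OF that] pG by (metis less_le)
  have "\<exists>A \<subseteq> atoms. card A = atom_defect X {} f \<and> f = Sup ({} \<union> {y \<in> X. y < f} \<union> A)" for f :: 'a
    using atom_defect_attained[OF at, of "{}" f X] by auto
  then obtain A where A: "\<And>f. A f \<subseteq> atoms" "\<And>f. card (A f) = atom_defect X {} f"
      "\<And>f. f = Sup ({y \<in> X. y < f} \<union> A f)"
    by (metis Un_empty_left)
  let ?A = "\<Union>f\<in>F - X. A f"
  let ?Y = "{} \<union> {y \<in> X. y < p} \<union> ?A"
  have "f \<le> Sup ?Y" if f: "f \<in> F" for f
  proof (cases "f \<in> X")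
    case True
    then show ?thesis using fp[OF f] by (intro Sup_upper) auto
  next
    case False
    have "Sup ({y \<in> X. y < f} \<union> A f) \<le> Sup ?Y"
      using False f fp[OF f] by (intro Sup_subset_mono) (auto intro: less_trans)
    then show ?thesis using A(3)[of f] by simp
  qed
  then have "p \<le> Sup ?Y" using Sup_factors by (metis Sup_least)
  moreover have "a \<le> p" if "f \<in> F" "a \<in> A f" for f a
  proof -
    have "a \<le> Sup ({y \<in> X. y < f} \<union> A f)" using that by (intro Sup_upper) auto
    then show ?thesis using A(3)[of f] factorsD[OF that(1)] by (metis order_trans)
  qed
  then have "Sup ?Y \<le> p" by (intro Sup_least) (auto intro: less_imp_le)
  ultimately have "p = Sup ?Y" by (rule antisym)
  then have "atom_defect X {} p \<le> card ?A" using A(1) by (intro atom_defect_le) auto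
  also have "\<dots> \<le> (\<Sum>f\<in>F - X. card (A f))" by (rule card_UN_le) simp
  finally show "atom_defect X {} p \<le> (\<Sum>f\<in>F - X. atom_defect X {} f)" by (simp add: A(2))
next
  have bot: "bot \<notin> G" using G unfolding building_set_def by auto
  obtain A where A: "A \<subseteq> atoms" "card A = atom_defect X {} p" "p = Sup ({} \<union> {y \<in> X. y < p} \<union> A)"
    using atom_defect_attained[OF at, of "{}" p X] by blast
  let ?X = "{y \<in> X. y < p}"
  have p_eq: "p = Sup (?X \<union> A)" using A(3) by simp
  have below: "\<exists>f\<in>F. y \<le> f" if "y \<in> ?X \<union> A" for y
  proof -
    have "y \<in> G" using that X A(1) building_atoms[OF G] by blast
    moreover have "y \<le> p" using Sup_upper[OF that] p_eq by simp
    ultimately show ?thesis by (rule below_factor)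
  qed
  define A' where "A' f = {a \<in> A. a \<le> f}" for f
  have le: "atom_defect X {} f \<le> card (A' f)" if f: "f \<in> F - X" for f
  proof (rule atom_defect_le)
    show "A' f \<subseteq> atoms" using A(1) by (auto simp: A'_def)
    let ?u = "Sup ({} \<union> {y \<in> X. y < f} \<union> A' f)"
    have "?u \<le> f" by (intro Sup_least) (auto simp: A'_def)
    moreover have "p \<le> sup ?u (Sup (F - {f}))"
    proof -
      have "y \<le> sup ?u (Sup (F - {f}))" if y: "y \<in> ?X \<union> A" for y
      proof (cases "y \<le> f")
        case True
        then have "y \<in> {} \<union> {y \<in> X. y < f} \<union> A' f" using y f by (auto simp: A'_def less_le)
        then show ?thesis by (intro le_supI1 Sup_upper)
      next
        case False
        then obtain g where "g \<in> F - {f}" "y \<le> g" using below[OF y] by blast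
        then show ?thesis by (intro le_supI2) (auto intro: order_trans Sup_upper)
      qed
      then have "Sup (?X \<union> A) \<le> sup ?u (Sup (F - {f}))" by (rule Sup_least)
      then show ?thesis using p_eq by simp
    qed
    ultimately have "?u = f" using f by (intro factor_complement) auto
    then show "f = ?u" by simp
  qed
  have "a \<noteq> bot" if "a \<in> A" for a using that A(1) building_atoms[OF G] bot by blast
  then have "A' f \<inter> A' g = {}" if "f \<in> F" "g \<in> F" "f \<noteq> g" for f g
    using factors_disjoint[OF that] by (auto simp: A'_def)
  then have "(\<Sum>f\<in>F - X. card (A' f)) = card (\<Union>f\<in>F - X. A' f)"
    by (intro card_UN_disjoint[symmetric]) auto
  also have "\<dots> \<le> card A" by (intro card_mono) (auto simp: A'_def)
  finally show "(\<Sum>f\<in>F - X. atom_defect X {} f) \<le> atom_defect X {} p"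
    using le sum_mono[of "F - X" "atom_defect X {}" "\<lambda>f. card (A' f)"] A(2) by simp
qed

text \<open>For \<open>f \<notin> I\<close>, adding \<open>f\<close> to \<open>H\<close> multiplies the weight by \<open>atom_defect (I \<union> H) {} f - 1\<close>, so
  each pair \<open>H\<close>, \<open>insert f H\<close> contributes the same to both sides.\<close>

lemma weighted_atom_defect_factor:
  fixes I :: "'a set"
  assumes f: "f \<in> F"
  defines "V \<equiv> {g \<in> G. g \<le> p}"
  shows "(\<Sum>H\<in>Pow V. weight I H * (if f \<in> I \<union> H then 0 else int (atom_defect (I \<union> H) {} f))) =
    (if f \<in> I then 0 else (\<Sum>H\<in>Pow V. weight I H))"
proof (cases "f \<in> I")
  case False
  define V' where "V' = V - {f}"
  have V: "V = insert f V'" "f \<notin> V'" using factorsD[OF f] by (auto simp: V_def V'_def)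
  have step: "weight I (insert f H) = (int (atom_defect (I \<union> H) {} f) - 1) * weight I H"
    if H: "H \<in> Pow V'" for H
  proof -
    \<comment> \<open>A factor is maximal among the elements of \<open>G\<close> below
      \<open>p\<close>, so its presence changes no defect at a member of \<open>H\<close>, nor at
      \<open>f\<close> itself.\<close>
    have "\<not> f < A" if "A \<in> H" for A
      using that H factors_maximal[OF f] by (auto simp: V'_def V_def)
    then have "atom_defect (I \<union> insert f H) {} A = atom_defect (I \<union> H) {} A" if "A \<in> insert f H" for A
      using that by (intro atom_defect_cong) auto
    moreover have "f \<notin> H" using H V(2) by blast
    ultimately show ?thesis by (simp add: weight_def)
  qed
  \<comment> \<open>Subsets containing \<open>f\<close> contribute 0 to this sum; the weight of
    \<open>insert f H\<close> comes back from splitting the term of \<open>H\<close>.\<close>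
  have "(\<Sum>H\<in>Pow V. weight I H * (if f \<in> I \<union> H then 0 else int (atom_defect (I \<union> H) {} f))) =
      (\<Sum>H\<in>Pow V'. weight I H * int (atom_defect (I \<union> H) {} f))"
    unfolding V(1) using V(2) False by (subst sum_Pow_insert) (auto intro!: sum.cong)
  also have "\<dots> = (\<Sum>H\<in>Pow V'. weight I H + weight I (insert f H))"
    by (intro sum.cong) (simp_all add: step algebra_simps)
  also have "\<dots> = (\<Sum>H\<in>Pow V. weight I H)"
    unfolding V(1) using V(2) by (simp add: sum_Pow_insert)
  finally show ?thesis using False by simp
qed simp

lemma weighted_atom_defect:
  assumes at: "atomic TYPE('a)" and pG: "p \<notin> G" and I: "\<And>x. x \<in> I \<Longrightarrow> x < p \<Longrightarrow> x \<in> G"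
  defines "V \<equiv> {g \<in> G. g \<le> p}"
  shows "(\<Sum>H\<in>Pow V. weight I H * int (atom_defect (I \<union> H) {} p)) =
    int (card (F - I)) * (\<Sum>H\<in>Pow V. weight I H)"
proof -
  have "int (atom_defect (I \<union> H) {} p) =
      (\<Sum>f\<in>F. if f \<in> I \<union> H then 0 else int (atom_defect (I \<union> H) {} f))" if "H \<in> Pow V" for H
  proof -
    have "atom_defect (I \<union> H) {} p = (\<Sum>f\<in>F - (I \<union> H). atom_defect (I \<union> H) {} f)"
      using that I by (intro atom_defect_factors[OF at pG]) (auto simp: V_def)
    then show ?thesis
      by (simp add: sum.If_cases Diff_eq Compl_eq)
  qed
  then have "(\<Sum>H\<in>Pow V. weight I H * int (atom_defect (I \<union> H) {} p)) =
      (\<Sum>H\<in>Pow V. \<Sum>f\<in>F. weight I H * (if f \<in> I \<union> H then 0 else int (atom_defect (I \<union> H) {} f)))"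
    by (simp add: sum_distrib_left)
  also have "\<dots> = (\<Sum>f\<in>F. if f \<in> I then 0 else (\<Sum>H\<in>Pow V. weight I H))"
    by (subst sum.swap) (intro sum.cong refl weighted_atom_defect_factor[folded V_def])
  also have "\<dots> = (\<Sum>f\<in>F - I. \<Sum>H\<in>Pow V. weight I H)"
    by (intro sum.mono_neutral_cong_right) auto
  finally show ?thesis by simp
qed

end

section \<open>Adding one element to a building set\<close>

locale building_extension = building_factors G b for G :: "'a::{finite, complete_lattice} set" and b +
  assumes at: "atomic TYPE('a)" and bG: "b \<notin> G" and ext: "building_set (insert b G)"
begin

abbreviation "U \<equiv> {g \<in> G. \<not> g \<le> b}"
abbreviation "V \<equiv> {g \<in> G. g \<le> b}"

text \<open>\<open>D_ideal_same_join\<close> asks for \<open>b\<close> to be a member, so it is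
  applied in the larger building set, which has the same elements not below
  \<open>b\<close>.\<close>

lemma chi_arr_U_same_join:
  assumes "X \<subseteq> insert b G" "Sup X = b"
  shows "chi_arr U (I \<union> X) = chi_arr U (insert b I)"
proof -
  have "{g \<in> insert b G. \<not> g \<le> b} = U" by auto
  then show ?thesis
    using D_ideal_same_join[OF at building_join_closed[OF ext], of b X I] assms by (intro chi_arr_cong) simp
qed

lemma chi_arr_G: "chi_arr G I = (\<Sum>H\<in>Pow V. weight I H * chi_arr U (I \<union> H))"
proof -
  have "U \<union> V = G" by auto
  moreover have "up_closed G U" "up_closed G G" by (auto simp: up_closed_def intro: order_trans)
  ultimately show ?thesis
    using chi_arr_unroll[OF at building_join_closed[OF G], of U V I] by auto
qed

text \<open>Every \<open>F \<union> H\<close> has join \<open>b\<close>, so all terms share one ring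
  over \<open>U\<close>. The weights ignore \<open>F\<close>, because no element of \<open>V\<close>
  lies strictly above a factor.\<close>

lemma chi_arr_G_factors: "chi_arr G (I \<union> F) = chi_arr U (insert b I) * (\<Sum>H\<in>Pow V. weight I H)"
proof -
  have "weight (I \<union> F) H * chi_arr U (I \<union> F \<union> H) = chi_arr U (insert b I) * weight I H" if H: "H \<in> Pow V" for H
  proof -
    have "atom_defect (I \<union> F \<union> H) {} A = atom_defect (I \<union> H) {} A" if "A \<in> H" for A
      using that H factors_maximal[of _ G b A] by (intro atom_defect_cong) auto
    then have "weight (I \<union> F) H = weight I H" by (simp add: weight_def)
    moreover have "Sup (F \<union> H) = b"
    proof (rule antisym)
      show "Sup (F \<union> H) \<le> b" using H by (intro Sup_least) (auto dest: factorsD)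
      have "Sup F \<le> Sup (F \<union> H)" by (intro Sup_subset_mono) auto
      then show "b \<le> Sup (F \<union> H)" using Sup_factors by simp
    qed
    then have "chi_arr U (I \<union> (F \<union> H)) = chi_arr U (insert b I)"
      using H by (intro chi_arr_U_same_join) (auto dest: factorsD)
    ultimately show ?thesis by (simp add: Un_assoc)
  qed
  then show ?thesis by (simp add: chi_arr_G sum_distrib_left)
qed

text \<open>The elements of \<open>V\<close> are removed first and \<open>b\<close> next. The center
  of \<open>b\<close> has the same rank for every \<open>H\<close>, since \<open>b\<close> with any
  \<open>H\<close> below it has join \<open>b\<close>; only the defect of \<open>b\<close> still
  depends on \<open>H\<close>, and \<open>weighted_atom_defect\<close> evaluates its weighted
  sum.\<close>

lemma chi_arr_ext:
  assumes I: "I \<subseteq> insert b G"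
  shows "chi_arr (insert b G) I = chi_arr G I + (int (card (F - I)) - 1) * chi_arr G (I \<union> F)"
proof -
  note jc = building_join_closed[OF ext]
  have up: "up_closed (insert b G) U" "up_closed (insert b G) (insert b U)"
      "up_closed (insert b G) (insert b U \<union> V)"
    by (auto simp: up_closed_def intro: order_trans)
  have eq: "insert b U \<union> V = insert b G" "insert b U \<inter> V = {}" using bG by auto
  have "chi_arr (insert b U) (I \<union> H) =
      chi_arr U (I \<union> H) + (int (atom_defect (I \<union> H) {} b) - 1) * chi_arr U (insert b I)"
    if H: "H \<in> Pow V" for H
  proof -
    have "Sup (insert b H) = b" using H by (intro antisym Sup_least Sup_upper) auto
    then have "chi_arr U (I \<union> insert b H) = chi_arr U (insert b I)"
      using H by (intro chi_arr_U_same_join) auto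
    then show ?thesis using chi_arr_insert[OF at jc up(1,2), of "I \<union> H"] by simp
  qed
  then have "chi_arr (insert b G) I = (\<Sum>H\<in>Pow V. weight I H *
      (chi_arr U (I \<union> H) + (int (atom_defect (I \<union> H) {} b) - 1) * chi_arr U (insert b I)))"
    using chi_arr_unroll[OF at jc up(2,3) eq(2), of I] unfolding eq(1) by simp
  also have "\<dots> = chi_arr G I + chi_arr U (insert b I) *
      ((\<Sum>H\<in>Pow V. weight I H * int (atom_defect (I \<union> H) {} b)) - (\<Sum>H\<in>Pow V. weight I H))"
    by (simp add: chi_arr_G algebra_simps sum.distrib sum_subtractf sum_distrib_left sum_distrib_right)
  also have "(\<Sum>H\<in>Pow V. weight I H * int (atom_defect (I \<union> H) {} b)) =
      int (card (F - I)) * (\<Sum>H\<in>Pow V. weight I H)"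
    using I by (intro weighted_atom_defect[OF at bG]) auto
  finally show ?thesis by (simp add: chi_arr_G_factors algebra_simps)
qed

text \<open>Here \<open>b\<close> has no variable in the ring over \<open>G\<close> and acts only
  through defects. It lies strictly below no element of \<open>V\<close>, so the weights ignore it;
  over \<open>U\<close> it acts like any set with join \<open>b\<close>, in particular like
  \<open>F\<close>.\<close>

lemma chi_arr_G_mem:
  assumes "b \<in> I"
  shows "chi_arr G I = chi_arr G (I - {b} \<union> F)"
proof -
  have "chi_arr U (I \<union> H) = chi_arr U (insert b I)" if H: "H \<in> Pow V" for H
  proof -
    have "Sup (insert b H) = b" using H by (intro antisym Sup_least Sup_upper) auto
    then have "chi_arr U (I \<union> insert b H) = chi_arr U (insert b I)"
      using H by (intro chi_arr_U_same_join) auto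
    moreover have "I \<union> insert b H = I \<union> H" using assms by auto
    ultimately show ?thesis by simp
  qed
  moreover have "weight I H = weight (I - {b}) H" if H: "H \<in> Pow V" for H
  proof -
    have "atom_defect (I \<union> H) {} A = atom_defect (I - {b} \<union> H) {} A" if "A \<in> H" for A
      using that H by (intro atom_defect_cong) auto
    then show ?thesis by (simp add: weight_def)
  qed
  ultimately have "chi_arr G I = chi_arr U (insert b I) * (\<Sum>H\<in>Pow V. weight (I - {b}) H)"
    by (simp add: chi_arr_G[of I] sum_distrib_left mult.commute)
  then show ?thesis using chi_arr_G_factors[of "I - {b}"] by simp
qed

text \<open>By \<open>chi_arr_G_mem\<close> both terms of \<open>chi_arr_ext\<close> are multiples
  of the same rank, with coefficients \<open>1\<close> and \<open>|F - I| - 1\<close>.\<close>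

lemma chi_arr_ext_mem:
  assumes I: "I \<subseteq> insert b G" and b: "b \<in> I"
  shows "chi_arr (insert b G) I = chi_arr G (I - {b} \<union> F) * int (card (F - I))"
proof -
  have "b \<notin> F" using bG factorsD by blast
  have "chi_arr G (I \<union> F) = chi_arr G (I - {b} \<union> F)"
    using chi_arr_G_mem[of "I \<union> F"] b \<open>b \<notin> F\<close> by (simp add: Un_Diff Un_assoc)
  then show ?thesis
    using chi_arr_ext[OF I] chi_arr_G_mem[OF b] by (simp add: algebra_simps)
qed

end

theorem theorem3:
  assumes "ranked TYPE('a::{finite, complete_lattice})"
    and "atomic TYPE('a)"
  shows "N_function (chi_arr :: 'a set \<Rightarrow> 'a set \<Rightarrow> int)"
  unfolding N_function_def Let_def
proof (intro allI impI ballI)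
  fix G\<^sub>1 G\<^sub>2 S :: "'a set" and b :: 'a
  assume G: "building_set G\<^sub>1" "building_set G\<^sub>2" and G2: "G\<^sub>2 = G\<^sub>1 \<union> {b}" and b: "b \<notin> G\<^sub>1"
    and "S \<in> nested_sets G\<^sub>2"
  have S: "S \<subseteq> insert b G\<^sub>1" using \<open>S \<in> nested_sets G\<^sub>2\<close> G2 by (auto simp: nested_sets_def)
  have G2': "G\<^sub>2 = insert b G\<^sub>1" using G2 by simp
  have "b \<noteq> bot" using G(2) unfolding building_set_def G2' by auto
  interpret building_extension G\<^sub>1 b
    using G b assms(2) \<open>b \<noteq> bot\<close> unfolding G2' by unfold_locales
  \<comment> \<open>In the case that is not nested the correction term vanishes, which makes the
    first two cases one formula.\<close>
  have "chi_arr G\<^sub>1 (S \<union> F) = 0" if "b \<notin> S" "S \<union> F \<notin> nested_sets G\<^sub>1"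
    using that S by (intro chi_arr_not_nested) (auto dest: factorsD)
  then show "(b \<notin> S \<and> S \<union> F \<notin> nested_sets G\<^sub>1 \<longrightarrow> chi_arr G\<^sub>2 S = chi_arr G\<^sub>1 S) \<and>
      (b \<notin> S \<and> S \<union> F \<in> nested_sets G\<^sub>1 \<longrightarrow>
        chi_arr G\<^sub>2 S = chi_arr G\<^sub>1 S + chi_arr G\<^sub>1 (S \<union> F) * (int (card (F - S)) - 1)) \<and>
      (b \<in> S \<longrightarrow> chi_arr G\<^sub>2 S = chi_arr G\<^sub>1 (S - {b} \<union> F) * int (card (F - S)))"
    using chi_arr_ext[OF S] chi_arr_ext_mem[OF S] unfolding G2' by simp
qed

end
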